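(* Let $n\geq 2$, let $\lambda$ be an arc in $\mathbb{R}^n$, and let $\Omega\subset\mathbb{R}^n$ be an open set containing $\lambda$. Then there is a simple closed curve $\gamma\subset\Omega$ with $\lambda\subset\gamma$ such that the open arc $\gamma\setminus\lambda$ is $\mathcal{C}^\infty$-smooth.
   Context: An arc is a space homeomorphic to $[0,1]$; a simple closed curve is a space homeomorphic to the unit circle. *)

theory Defs
  imports "HOL-Analysis.Analysis"
begin

definition is_arc :: "'a::topological_space set \<Rightarrow> bool" where
  "is_arc S \<longleftrightarrow> S homeomorphic {0..(1::real)}"

definition simple_closed_curve :: "'a::topological_space set \<Rightarrow> bool" where
  "simple_closed_curve S \<longleftrightarrow> S homeomorphic sphere (0::complex) 1"

definition C_infinity_on :: "real set \<Rightarrow> (real \<Rightarrow> 'a::real_normed_vector) \<Rightarrow> bool" where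
  "C_infinity_on S g \<longleftrightarrow>
     (\<exists>D :: nat \<Rightarrow> real \<Rightarrow> 'a. (\<forall>t\<in>S. D 0 t = g t) \<and>
        (\<forall>k. \<forall>t\<in>S. (D k has_vector_derivative D (Suc k) t) (at t)))"

definition smooth_open_arc :: "'a::real_normed_vector set \<Rightarrow> bool" where
  "smooth_open_arc A \<longleftrightarrow>
     (\<exists>g h. homeomorphism {0<..<(1::real)} A g h \<and> C_infinity_on {0<..<1} g \<and>
        (\<forall>t\<in>{0<..<1}. vector_derivative g (at t) \<noteq> 0))"

end

theory Submission
  imports Defs "HOL-Computational_Algebra.Polynomial"
begin

text \<open>A short straight segment in \<open>\<Omega> - lam\<close> is carried to the required open arc by pushing its two ends
  towards the endpoints of \<open>lam\<close> by infinitely many maps \<open>z \<mapsto> z + b(z) v\<close>, where \<open>b\<close> is a smooth bump and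
  \<open>v\<close> so small that the map is injective. The supports avoid \<open>lam\<close> and shrink to the endpoint, so a
  point of the segment either moves only finitely often, as do all points near it, or converges to the
  endpoint. Cutting the segment at the first point that moves for ever leaves a limit curve that is
  locally a finite composition of pushes, hence smooth, regular and injective.

  Such pushes exist because the complement of an arc is locally connected at the endpoints of the arc.
  By Borsuk's criterion, two points of the complement of a compact set \<open>S\<close> are connected there iff their
  central projections from \<open>S\<close> to the sphere are homotopic, and attaching an arc to \<open>S\<close> at one end does not
  affect homotopies, since it retracts.\<close>

subsection \<open>Separation by arcs\<close>

text \<open>Sliding the arc along itself towards its end on \<open>K\<close> deforms
  \<open>K \<union> path_image g\<close> onto \<open>K\<close>. Borsuk's criterion turns the
  connection of \<open>a\<close> and \<open>b\<close> off \<open>K\<close> into a homotopy of their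
  projections on \<open>K\<close>; composing with the retraction extends it to the union, and the
  criterion is then read backwards.\<close>

lemma connected_component_Compl_Un_arc:
  fixes g :: "real \<Rightarrow> 'a::euclidean_space"
  assumes dim: "2 \<le> DIM('a)" and g: "arc g" and K: "compact K"
    and meet: "K \<inter> path_image g = {pathfinish g}"
    and ab: "connected_component (- K) a b" "a \<notin> path_image g" "b \<notin> path_image g"
  shows "connected_component (- (K \<union> path_image g)) a b"
proof -
  define C where "C = path_image g"
  define S where "S = K \<union> C"
  have notin: "a \<notin> S" "b \<notin> S" "a \<notin> K" "b \<notin> K"
    using ab connected_component_in by (fastforce simp: S_def C_def)+
  have cC: "compact C" unfolding C_def using g by (simp add: compact_arc_image)
  have cS: "compact S" unfolding S_def using K cC by blast
  obtain h where h: "homeomorphism {0..1} C g h"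
    using g homeomorphism_arc unfolding C_def by metis
  have hg: "h (g t) = t" if "t \<in> {0..1}" for t
    using h that by (simp add: homeomorphism_apply1)
  have gh: "g (h x) = x" if "x \<in> C" for x
    using homeomorphism_apply2[OF h that] .
  have h01: "h x \<in> {0..1}" if "x \<in> C" for x
    using homeomorphism_image2[OF h] that by blast
  \<comment> \<open>At time \<open>t\<close> the arc point of parameter \<open>s\<close> has moved
    to parameter \<open>(1 - t) * s + t\<close>, while \<open>K\<close> stays fixed. The only common
    point has parameter 1, which never moves, so the two clauses agree there.\<close>
  define H where "H = (\<lambda>z. if snd z \<in> K then snd z else g ((1 - fst z) * h (snd z) + fst z))"
  have seg: "(1 - t) * s + t \<in> {0..1}" if "s \<in> {0..1}" "t \<in> {0..1}" for s t :: real
  proof -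
    have "0 \<le> (1 - t) * (1 - s)" "0 \<le> (1 - t) * s"
      using that by (auto intro!: mult_nonneg_nonneg)
    moreover have "1 - ((1 - t) * s + t) = (1 - t) * (1 - s)" by (simp add: algebra_simps)
    ultimately show ?thesis using that unfolding atLeastAtMost_iff by linarith
  qed
  have "continuous_on ({0..1} \<times> K \<union> {0..1} \<times> C) H"
    unfolding H_def
  proof (rule continuous_on_cases_local)
    show "closedin (top_of_set ({0..1::real} \<times> K \<union> {0..1} \<times> C)) ({0..1} \<times> K)"
      "closedin (top_of_set ({0..1::real} \<times> K \<union> {0..1} \<times> C)) ({0..1} \<times> C)"
      using compact_imp_closed[OF K] compact_imp_closed[OF cC]
      by (auto intro!: closed_subset closed_Times)
    show "continuous_on ({0..1::real} \<times> K) snd" by (intro continuous_intros)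
    have "continuous_on {0..1} g" using h by (simp add: homeomorphism_def)
    moreover have "continuous_on C h" using h by (simp add: homeomorphism_def)
    then have "continuous_on ({0..1::real} \<times> C) (\<lambda>z. h (snd z))"
      by (rule continuous_on_compose2[of C h _ snd]) (intro continuous_intros, force)
    then have "continuous_on ({0..1::real} \<times> C) (\<lambda>z. (1 - fst z) * h (snd z) + fst z)"
      by (intro continuous_intros)
    moreover have "(1 - fst z) * h (snd z) + fst z \<in> {0..1}" if "z \<in> {0..1::real} \<times> C" for z
      by (rule seg[OF h01]) (use that in \<open>simp_all add: mem_Times_iff\<close>)
    then have "(\<lambda>z. (1 - fst z) * h (snd z) + fst z) ` ({0..1::real} \<times> C) \<subseteq> {0..1}"
      by blast
    ultimately show "continuous_on ({0..1} \<times> C) (\<lambda>z. g ((1 - fst z) * h (snd z) + fst z))"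
      using continuous_on_compose2[OF \<open>continuous_on {0..1} g\<close>] by blast
  next
    fix z assume "z \<in> {0..1::real} \<times> K \<and> snd z \<notin> K \<or> z \<in> {0..1} \<times> C \<and> snd z \<in> K"
    then have z: "fst z \<in> {0..1}" "snd z \<in> K \<inter> C" by auto
    then have "snd z = g 1" using meet by (auto simp: C_def pathfinish_def)
    moreover have "h (g 1) = 1" by (simp add: hg)
    ultimately show "snd z = g ((1 - fst z) * h (snd z) + fst z)" by simp
  qed
  then have contH: "continuous_on ({0..1} \<times> S) H" by (simp add: S_def Sigma_Un_distrib2)
  have Him: "H (t, x) \<in> S" if "t \<in> {0..1}" "x \<in> S" for t x
  proof (cases "x \<in> K")
    case True then show ?thesis by (simp add: H_def S_def)
  next
    case False
    then have "x \<in> C" using that by (simp add: S_def)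
    then have "g ((1 - t) * h x + t) \<in> C"
      using seg[OF h01 that(1)] by (simp add: C_def path_image_def)
    then show ?thesis using False by (simp add: H_def S_def)
  qed
  define r where "r = (\<lambda>x. H (1, x))"
  have H0: "H (0, x) = x" if "x \<in> S" for x
    using that gh by (auto simp: H_def S_def)
  have idr: "homotopic_with_canon (\<lambda>_. True) S S id r"
  proof (subst homotopic_with)
    show "\<exists>h. continuous_map (prod_topology (top_of_set {0..1::real}) (top_of_set S)) (top_of_set S) h \<and>
        (\<forall>x\<in>topspace (top_of_set S). h (0, x) = id x) \<and>
        (\<forall>x\<in>topspace (top_of_set S). h (1, x) = r x) \<and> (\<forall>t\<in>{0..1}. True)"
      using contH Him H0 by (intro exI[of _ H]) (auto simp: r_def)
  qed simp
  have rK: "r x \<in> K" for x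
    using meet by (auto simp: r_def H_def pathfinish_def)
  have contr: "continuous_on S r"
    using idr homotopic_with_imp_continuous by blast
  \<comment> \<open>\<open>f c\<close> is the Borsuk map of \<open>c\<close>, the central projection
    from \<open>c\<close> to the unit sphere.\<close>
  define f where "f = (\<lambda>c x::'a. (x - c) /\<^sub>R norm (x - c))"
  \<comment> \<open>The deformation stays inside \<open>S\<close>, so it never meets
    \<open>c\<close>, and projecting it from \<open>c\<close> gives the homotopy.\<close>
  have fid: "homotopic_with_canon (\<lambda>_. True) S (sphere 0 1) (f c) (f c \<circ> r)" if "c \<notin> S" for c
  proof -
    have "homotopic_with_canon (\<lambda>_. True) S (sphere 0 1) (f c \<circ> id) (f c \<circ> r)"
    proof (rule homotopic_with_compose_continuous_left)
      show "homotopic_with_canon (\<lambda>_. True) S S id r" by (rule idr)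
      show "continuous_on S (f c)" unfolding f_def
        using that by (intro continuous_intros) auto
      show "f c \<in> S \<rightarrow> sphere 0 1" using that by (auto simp: f_def divide_simps)
    qed
    then show ?thesis by simp
  qed
  have "homotopic_with_canon (\<lambda>_. True) K (sphere 0 1) (f a) (f b)"
    using Borsuk_maps_homotopic_in_connected_component_eq[OF K notin(3,4) dim] ab(1)
    unfolding f_def by simp
  then have "homotopic_with_canon (\<lambda>_. True) S (sphere 0 1) (f a \<circ> r) (f b \<circ> r)"
    by (rule homotopic_with_compose_continuous_right) (use contr rK in auto)
  then have "homotopic_with_canon (\<lambda>_. True) S (sphere 0 1) (f a) (f b)"
    using fid notin by (meson homotopic_with_symD homotopic_with_trans)
  then show ?thesis
    using Borsuk_maps_homotopic_in_connected_component_eq[OF cS notin(1,2) dim]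
    unfolding f_def S_def C_def by simp
qed

text \<open>A connected set that meets \<open>U\<close> and misses its frontier cannot leave
  \<open>U\<close>. This localises the conclusions drawn from Borsuk's criterion, which speaks of
  whole complements.\<close>

lemma connected_component_Diff_from_frontier:
  assumes "connected_component (- (frontier U \<union> L)) a b" "a \<in> U"
  shows "connected_component (U - L) a b"
proof -
  obtain T where T: "connected T" "T \<subseteq> - (frontier U \<union> L)" "a \<in> T" "b \<in> T"
    using assms(1) by (auto simp: connected_component_def)
  then have "T \<subseteq> U" using connected_Int_frontier[of T U] assms(2) by blast
  with T show ?thesis unfolding connected_component_def by blast
qed

text \<open>Cut the arc so that its initial piece lies in the \<open>e\<close>-ball. The sphere and
  the rest of the arc form a compact set that misses the starting point, so a small ball about that
  point is connected off it. Reattaching the initial piece, which touches this set only at its far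
  end, separates nothing.\<close>

lemma arc_complement_locally_connected_at_start:
  fixes g :: "real \<Rightarrow> 'a::euclidean_space"
  assumes dim: "2 \<le> DIM('a)" and g: "arc g" and e: "0 < e"
  shows "\<exists>d>0. \<forall>x y. x \<in> ball (pathstart g) d - path_image g \<longrightarrow> y \<in> ball (pathstart g) d - path_image g
           \<longrightarrow> connected_component (ball (pathstart g) e - path_image g) x y"
proof -
  define p where "p = pathstart g"
  have contg: "continuous_on {0..1} g" and injg: "inj_on g {0..1}"
    using g by (auto simp: arc_def path_def)
  have "\<exists>d>0. \<forall>x\<in>{0..1}. dist x 0 < d \<longrightarrow> dist (g x) (g 0) < e"
    using contg e unfolding continuous_on_iff by (metis atLeastAtMost_iff order_refl zero_le_one)
  then obtain d0 where d0: "d0 > 0" "\<And>x. x \<in> {0..1} \<Longrightarrow> dist x 0 < d0 \<Longrightarrow> dist (g x) (g 0) < e" by blast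
  \<comment> \<open>Halving gives \<open>s < d0\<close>, so the whole piece up to \<open>s\<close>
    stays in the ball. If the minimum is 1, the remaining piece is just the end point.\<close>
  define s where "s = min 1 (d0/2)"
  have s: "0 < s" "s \<le> 1" "s < d0" using d0 by (auto simp: s_def)
  have near: "g ` {0..s} \<subseteq> ball p e"
    using d0(2) s by (auto simp: p_def pathstart_def dist_commute)
  define K where "K = sphere p e \<union> g ` {s..1}"
  have sub: "path_image (subpath 0 s g) = g ` {0..s}" using s by (simp add: path_image_subpath)
  have img: "path_image g = g ` {0..s} \<union> g ` {s..1}"
    using s by (simp add: path_image_def image_Un[symmetric] ivl_disj_un)
  have cK: "compact K" unfolding K_def
    using s by (intro compact_Un compact_sphere compact_continuous_image continuous_on_subset[OF contg]) auto
  have "p \<notin> g ` {s..1}"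
    using inj_onD[OF injg, of 0] s by (force simp: p_def pathstart_def)
  then have "p \<notin> K" using e by (auto simp: K_def)
  then obtain d where d: "d > 0" "ball p d \<subseteq> - K"
    using cK by (meson ComplI compact_imp_closed open_Compl openE)
  have arcs: "arc (subpath 0 s g)" using g s by (intro arc_subpath_arc) auto
  \<comment> \<open>By injectivity the two pieces share only \<open>g s\<close>, and by
    \<open>near\<close> the first one misses the sphere, so the arc meets \<open>K\<close> exactly
    in its final point.\<close>
  have "g ` {0..s} \<inter> g ` {s..1} = g ` ({0..s} \<inter> {s..1})"
    using injg s by (intro inj_on_image_Int[symmetric, of g "{0..1}"]) auto
  also have "\<dots> = {g s}" using s by (simp add: atLeastAtMost_singleton)
  finally have cap: "K \<inter> path_image (subpath 0 s g) = {pathfinish (subpath 0 s g)}"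
    using near unfolding K_def sub by auto
  show ?thesis unfolding p_def[symmetric]
  proof (intro exI[of _ "min d e"] conjI allI impI)
    show "0 < min d e" using d e by simp
  next
    fix x y assume xy: "x \<in> ball p (min d e) - path_image g" "y \<in> ball p (min d e) - path_image g"
    then have "connected_component (- K) x y"
      unfolding connected_component_def
      by (intro exI[of _ "ball p d"]) (use d in auto)
    then have "connected_component (- (K \<union> path_image (subpath 0 s g))) x y"
      using connected_component_Compl_Un_arc[OF dim arcs cK cap] xy unfolding sub img by blast
    moreover have "K \<union> path_image (subpath 0 s g) = frontier (ball p e) \<union> path_image g"
      using e unfolding K_def sub img by auto
    ultimately show "connected_component (ball p e - path_image g) x y"
      using xy by (intro connected_component_Diff_from_frontier) auto
  qed
qed

text \<open>The same argument with the frontier of \<open>U\<close> as barrier. The end of the arc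
  is added to \<open>K\<close> so that the arc is attached to \<open>K\<close> at one end; removing
  that single point leaves \<open>U\<close> connected in dimension at least 2.\<close>

lemma connected_open_Diff_arc:
  fixes g :: "real \<Rightarrow> 'a::euclidean_space"
  assumes dim: "2 \<le> DIM('a)" and g: "arc g" and U: "open U" "connected U" "bounded U"
    and gU: "path_image g \<subseteq> U"
  shows "connected (U - path_image g)"
proof -
  have "connected_component (U - path_image g) a b"
    if a: "a \<in> U - path_image g" and b: "b \<in> U - path_image g" for a b
  proof -
    define K where "K = frontier U \<union> {pathfinish g}"
    have q: "pathfinish g \<in> path_image g" by (rule pathfinish_in_path_image)
    have disj: "frontier U \<inter> U = {}" using U(1) by (auto simp: frontier_def interior_open)
    have cK: "compact K" unfolding K_def using U(3) by (simp add: compact_frontier_bounded)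
    have cap: "K \<inter> path_image g = {pathfinish g}"
      using disj gU q unfolding K_def by blast
    have "connected (U - {pathfinish g})" using connected_open_delete[OF U(1,2) dim] .
    then have "connected_component (- K) a b"
      unfolding connected_component_def
      by (intro exI[of _ "U - {pathfinish g}"]) (use a b disj q in \<open>auto simp: K_def\<close>)
    then have "connected_component (- (K \<union> path_image g)) a b"
      using connected_component_Compl_Un_arc[OF dim g cK cap] a b by blast
    moreover have "K \<union> path_image g = frontier U \<union> path_image g" using q by (auto simp: K_def)
    ultimately show ?thesis using a by (intro connected_component_Diff_from_frontier) auto
  qed
  then show ?thesis by (auto simp: connected_iff_connected_component)
qed

text \<open>An interior would embed into the line, against invariance of dimension. This supplies
  points off the arc arbitrarily close to its ends.\<close>

lemma interior_arc_image_empty: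
  fixes g :: "real \<Rightarrow> 'a::euclidean_space"
  assumes dim: "2 \<le> DIM('a)" and g: "arc g"
  shows "interior (path_image g) = {}"
proof (rule ccontr)
  assume ne: "interior (path_image g) \<noteq> {}"
  obtain h where h: "homeomorphism {0..1} (path_image g) g h" using g homeomorphism_arc by metis
  have "continuous_on (interior (path_image g)) h"
    using h continuous_on_subset interior_subset unfolding homeomorphism_def by blast
  moreover have "inj_on h (interior (path_image g))"
    using h interior_subset by (metis homeomorphism_def inj_on_inverseI inj_on_subset)
  ultimately have "DIM('a) \<le> DIM(real)"
    using ne by (intro invariance_of_dimension[of _ h]) auto
  then show False using dim by simp
qed

subsection \<open>Smooth functions and bump functions\<close>

text \<open>Counting the order makes closure under sums, products and composition a plain induction:
  each step only has to exhibit one derivative, not a whole sequence of them.\<close>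

primrec differentiable_times :: "nat \<Rightarrow> real set \<Rightarrow> (real \<Rightarrow> 'a::real_normed_vector) \<Rightarrow> bool" where
  "differentiable_times 0 S g \<longleftrightarrow> True"
| "differentiable_times (Suc n) S g \<longleftrightarrow>
     (\<exists>g'. (\<forall>t\<in>S. (g has_vector_derivative g' t) (at t)) \<and> differentiable_times n S g')"

lemma differentiable_times_cong:
  assumes "differentiable_times n S g" "open S" "\<And>t. t \<in> S \<Longrightarrow> g t = h t"
  shows "differentiable_times n S h"
proof (cases n)
  case (Suc m)
  then obtain g' where g': "\<And>t. t \<in> S \<Longrightarrow> (g has_vector_derivative g' t) (at t)" "differentiable_times m S g'"
    using assms(1) by auto
  have "(h has_vector_derivative g' t) (at t)" if "t \<in> S" for t
    using has_vector_derivative_transform_within_open[OF g'(1)[OF that] assms(2) that] assms(3) by blast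
  then show ?thesis using g'(2) Suc by auto
qed simp

lemma differentiable_times_subset:
  "differentiable_times n S g \<Longrightarrow> T \<subseteq> S \<Longrightarrow> differentiable_times n T g"
  by (induction n arbitrary: g) (simp, metis differentiable_times.simps(2) subsetD)

lemma differentiable_times_SucD:
  "differentiable_times (Suc n) S g \<Longrightarrow> differentiable_times n S g"
  by (induction n arbitrary: g) (simp, metis differentiable_times.simps(2))

text \<open>Derivatives are unique on an open set, so the existential witness may be replaced by a
  canonical one. Local witnesses can then be glued and different orders compared.\<close>

lemma differentiable_times_Suc_iff:
  assumes "open S"
  shows "differentiable_times (Suc n) S g \<longleftrightarrow>
    (\<forall>t\<in>S. (g has_vector_derivative vector_derivative g (at t)) (at t)) \<and>
    differentiable_times n S (\<lambda>t. vector_derivative g (at t))" (is "?L \<longleftrightarrow> ?R")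
proof
  assume ?L
  then obtain g' where g': "\<And>t. t \<in> S \<Longrightarrow> (g has_vector_derivative g' t) (at t)" "differentiable_times n S g'"
    by auto
  have eq: "g' t = vector_derivative g (at t)" if "t \<in> S" for t
    using vector_derivative_at[OF g'(1)[OF that]] by simp
  then show ?R using g' differentiable_times_cong[OF g'(2) assms eq] by auto
qed auto

lemma differentiable_times_local:
  assumes "open S" "\<And>t. t \<in> S \<Longrightarrow> \<exists>T. open T \<and> t \<in> T \<and> differentiable_times n T g"
  shows "differentiable_times n S g"
  using assms(2)
proof (induction n arbitrary: g)
  case (Suc n)
  show ?case unfolding differentiable_times_Suc_iff[OF assms(1)]
  proof (intro conjI ballI Suc.IH)
    fix t assume "t \<in> S"
    then obtain T where T: "open T" "t \<in> T" "differentiable_times (Suc n) T g" using Suc.prems by blast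
    then have "(g has_vector_derivative vector_derivative g (at t)) (at t)"
       "differentiable_times n T (\<lambda>t. vector_derivative g (at t))"
      unfolding differentiable_times_Suc_iff[OF T(1)] by auto
    then show "(g has_vector_derivative vector_derivative g (at t)) (at t)"
      "\<exists>T. open T \<and> t \<in> T \<and> differentiable_times n T (\<lambda>t. vector_derivative g (at t))"
      using T by auto
  qed
qed simp

text \<open>Each order \<open>n\<close> comes with its own witnesses, but the canonical iterated
  derivatives serve all orders at once and form the required sequence \<open>D\<close>.\<close>

lemma C_infinity_on_iff:
  assumes "open S"
  shows "C_infinity_on S g \<longleftrightarrow> (\<forall>n. differentiable_times n S g)"
proof
  assume "C_infinity_on S g"
  then obtain D where D: "\<And>t. t \<in> S \<Longrightarrow> D 0 t = g t"
    "\<And>k t. t \<in> S \<Longrightarrow> (D k has_vector_derivative D (Suc k) t) (at t)"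
    unfolding C_infinity_on_def by blast
  have "differentiable_times n S (D k)" for n k
    by (induction n arbitrary: k) (use D(2) in auto)
  then show "\<forall>n. differentiable_times n S g"
    using differentiable_times_cong[OF _ assms, of _ "D 0" g] D(1) by blast
next
  assume *: "\<forall>n. differentiable_times n S g"
  define D where "D k = ((\<lambda>h t. vector_derivative h (at t)) ^^ k) g" for k
  have D: "\<forall>n. differentiable_times n S (D k)" for k
  proof (induction k)
    case (Suc k)
    then have "differentiable_times (Suc n) S (D k)" for n by blast
    then show ?case unfolding differentiable_times_Suc_iff[OF assms] by (simp add: D_def)
  qed (simp add: D_def *)
  have "(D k has_vector_derivative D (Suc k) t) (at t)" if "t \<in> S" for k t
    using D[of k, rule_format, of 1] that
    unfolding One_nat_def differentiable_times_Suc_iff[OF assms] by (simp add: D_def)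
  then show "C_infinity_on S g" unfolding C_infinity_on_def
    by (intro exI[of _ D]) (auto simp: D_def)
qed

lemma differentiable_times_add:
  "differentiable_times n S f \<Longrightarrow> differentiable_times n S g \<Longrightarrow> differentiable_times n S (\<lambda>t. f t + g t)"
proof (induction n arbitrary: f g)
  case (Suc n)
  then obtain f' g' where "\<forall>t\<in>S. (f has_vector_derivative f' t) (at t)" "differentiable_times n S f'"
    "\<forall>t\<in>S. (g has_vector_derivative g' t) (at t)" "differentiable_times n S g'" by auto
  then show ?case using Suc.IH
    by (auto intro!: exI[of _ "\<lambda>t. f' t + g' t"] has_vector_derivative_add)
qed simp

lemma differentiable_times_const: "differentiable_times n S (\<lambda>t. c)"
  by (induction n arbitrary: c) (auto intro!: exI[of _ "\<lambda>t. 0"] derivative_intros)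

lemma differentiable_times_ident: "differentiable_times n S (\<lambda>t::real. t)"
  by (cases n) (auto intro!: exI[of _ "\<lambda>t. 1"] derivative_intros differentiable_times_const)

text \<open>In the product rule the undifferentiated factors are needed only to order
  \<open>n\<close>, which they have by dropping one order, so the induction hypothesis covers both
  summands.\<close>

lemma differentiable_times_bilinear:
  assumes "bounded_bilinear pr"
  shows "differentiable_times n S f \<Longrightarrow> differentiable_times n S g \<Longrightarrow> differentiable_times n S (\<lambda>t. pr (f t) (g t))"
proof (induction n arbitrary: f g)
  case (Suc n)
  then obtain f' g' where *: "\<forall>t\<in>S. (f has_vector_derivative f' t) (at t)" "differentiable_times n S f'"
    "\<forall>t\<in>S. (g has_vector_derivative g' t) (at t)" "differentiable_times n S g'" by auto
  have "differentiable_times n S f" "differentiable_times n S g"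
    using Suc.prems differentiable_times_SucD by auto
  then have "differentiable_times n S (\<lambda>t. pr (f t) (g' t) + pr (f' t) (g t))"
    using * by (intro differentiable_times_add Suc.IH)
  moreover have "\<forall>t\<in>S. ((\<lambda>t. pr (f t) (g t)) has_vector_derivative pr (f t) (g' t) + pr (f' t) (g t)) (at t)"
    using * bounded_bilinear.has_vector_derivative[OF assms] by blast
  ultimately show ?case by auto
qed simp

lemma differentiable_times_compose:
  fixes u :: "real \<Rightarrow> real"
  shows "differentiable_times n S u \<Longrightarrow> differentiable_times n T f \<Longrightarrow> u ` S \<subseteq> T \<Longrightarrow> differentiable_times n S (\<lambda>t. f (u t))"
proof (induction n arbitrary: f)
  case (Suc n)
  then obtain f' u' where *: "\<forall>t\<in>T. (f has_vector_derivative f' t) (at t)" "differentiable_times n T f'"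
    "\<forall>t\<in>S. (u has_vector_derivative u' t) (at t)" "differentiable_times n S u'" by auto
  have "differentiable_times n S u"
    using Suc.prems(1) by (rule differentiable_times_SucD)
  then have "differentiable_times n S (\<lambda>t. f' (u t))"
    using *(2) Suc.prems(3) by (rule Suc.IH)
  with *(4) have "differentiable_times n S (\<lambda>t. u' t *\<^sub>R f' (u t))"
    by (rule differentiable_times_bilinear[OF bounded_bilinear_scaleR])
  moreover have "\<forall>t\<in>S. ((\<lambda>t. f (u t)) has_vector_derivative u' t *\<^sub>R f' (u t)) (at t)"
    using *(1,3) Suc.prems(3) vector_diff_chain_at[of u _ _ f] by (auto simp: o_def)
  ultimately show ?case by auto
qed simp

section \<open>Flat exponentials and the bump function\<close>

definition exp_flat :: "real poly \<Rightarrow> real \<Rightarrow> real" where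
  "exp_flat P x = (if 0 < x then poly P (1 / x) * exp (- (1 / x)) else 0)"

lemma poly_times_exp_minus_tendsto_0:
  "((\<lambda>y. poly P y * exp (- y)) \<longlongrightarrow> 0) (at_top :: real filter)"
proof -
  have "((\<lambda>y. \<Sum>i\<le>degree P. coeff P i * (y ^ i / exp y)) \<longlongrightarrow> 0) (at_top :: real filter)"
    by (intro tendsto_null_sum tendsto_mult_right_zero tendsto_power_div_exp_0)
  moreover have "(\<Sum>i\<le>degree P. coeff P i * (y ^ i / exp y)) = poly P y * exp (- y)" for y
    by (simp add: poly_altdef sum_distrib_right exp_minus divide_inverse mult.assoc)
  ultimately show ?thesis by simp
qed

text \<open>In terms of \<open>y = 1 / x\<close> the function is \<open>P(y)\<close> times the
  exponential of \<open>-y\<close>, and differentiation in \<open>x\<close> is \<open>-y^2\<close>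
  times differentiation in \<open>y\<close>. So the derivative has the same shape with polynomial
  \<open>y^2 (P - P')\<close>, and the whole family is closed under differentiation. At 0 the
  difference quotient from the right has this shape with \<open>y P(y)\<close> and tends to
  0.\<close>

lemma exp_flat_has_derivative:
  "(exp_flat P has_vector_derivative exp_flat ([:0, 0, 1:] * (P - pderiv P)) x) (at x)"
proof (cases x "0::real" rule: linorder_cases)
  case less
  have "((\<lambda>x. 0) has_vector_derivative 0) (at x)" by simp
  then have "(exp_flat P has_vector_derivative 0) (at x)"
    by (rule has_vector_derivative_transform_within_open[where S = "{..<0}"])
      (use less in \<open>auto simp: exp_flat_def\<close>)
  then show ?thesis using less by (simp add: exp_flat_def)
next
  case equal
  have "((\<lambda>y. exp_flat P y / y) \<longlongrightarrow> 0) (at_right 0)"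
  proof (rule Lim_transform_eventually)
    show "((\<lambda>y. poly (pCons 0 P) (inverse y) * exp (- inverse y)) \<longlongrightarrow> 0) (at_right (0::real))"
      using filterlim_compose[OF poly_times_exp_minus_tendsto_0 filterlim_inverse_at_top_right] .
    show "\<forall>\<^sub>F y in at_right 0. poly (pCons 0 P) (inverse y) * exp (- inverse y) = exp_flat P y / y"
      using eventually_at_right_less[of 0]
      by eventually_elim (simp add: exp_flat_def field_simps)
  qed
  moreover have "((\<lambda>y. exp_flat P y / y) \<longlongrightarrow> 0) (at_left 0)"
    by (rule Lim_transform_eventually[OF tendsto_const])
      (auto simp: eventually_at_left_field exp_flat_def intro: exI[of _ "-1"])
  ultimately have "((\<lambda>y. exp_flat P y / y) \<longlongrightarrow> 0) (at 0)"
    by (simp add: filterlim_split_at)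
  then have "(exp_flat P has_real_derivative 0) (at 0)"
    by (simp add: has_field_derivative_iff exp_flat_def)
  then show ?thesis using equal
    by (simp add: exp_flat_def has_real_derivative_iff_has_vector_derivative)
next
  case greater
  have "((\<lambda>x. poly P (1 / x) * exp (- (1 / x))) has_real_derivative exp_flat ([:0, 0, 1:] * (P - pderiv P)) x) (at x)"
    using greater
    by (auto intro!: derivative_eq_intros DERIV_chain2[OF poly_DERIV] simp: exp_flat_def field_simps power2_eq_square)
  then have "((\<lambda>x. poly P (1 / x) * exp (- (1 / x))) has_vector_derivative exp_flat ([:0, 0, 1:] * (P - pderiv P)) x) (at x)"
    by (simp add: has_real_derivative_iff_has_vector_derivative)
  then show ?thesis
    by (rule has_vector_derivative_transform_within_open[where S = "{0<..}"])
      (use greater in \<open>auto simp: exp_flat_def\<close>)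
qed

lemma differentiable_times_exp_flat: "differentiable_times n S (exp_flat P)"
  by (induction n arbitrary: P) (auto intro!: exI exp_flat_has_derivative)

text \<open>The bump is meant to be evaluated at a squared norm, which is smooth also at the centre.
  The Lipschitz bound is what later makes a small push injective.\<close>

lemma bump_function_exists:
  obtains b :: "real \<Rightarrow> real" and L where "\<And>n S. differentiable_times n S b" "b 0 = 1"
    "\<And>u. 1 \<le> u \<Longrightarrow> b u = 0" "0 < L"
    "\<And>z w :: 'a::real_normed_vector. \<bar>b ((norm z)\<^sup>2) - b ((norm w)\<^sup>2)\<bar> \<le> L * norm (z - w)"
proof -
  define b where "b u = exp 1 * exp_flat 1 (1 - u)" for u
  have smooth: "differentiable_times n S b" for n S
  proof -
    have 1: "differentiable_times n S (\<lambda>u. 1 + (-1) * u :: real)"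
      by (intro differentiable_times_add differentiable_times_const
          differentiable_times_bilinear[OF bounded_bilinear_mult] differentiable_times_ident)
    then have "differentiable_times n S (\<lambda>u. exp_flat 1 (1 - u))"
      using differentiable_times_compose[OF 1 differentiable_times_exp_flat[of n UNIV]] by simp
    then show ?thesis unfolding b_def
      by (intro differentiable_times_bilinear[OF bounded_bilinear_mult] differentiable_times_const)
  qed
  have b0: "b 0 = 1" by (simp add: b_def exp_flat_def exp_minus)
  have b1: "b u = 0" if "1 \<le> u" for u using that by (simp add: b_def exp_flat_def)
  obtain b' b'' where b': "\<And>u. (b has_vector_derivative b' u) (at u)"
      "\<And>u. (b' has_vector_derivative b'' u) (at u)"
    using smooth[of 2 UNIV] by (auto simp: numeral_2_eq_2)
  have "continuous_on {0..1} b'"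
    using b'(2) by (meson continuous_at_imp_continuous_on has_vector_derivative_continuous)
  then have "compact (b' ` {0..1})" by (intro compact_continuous_image) auto
  then obtain B where B: "B > 0" "\<And>u. u \<in> {0..1} \<Longrightarrow> norm (b' u) \<le> B"
    using compact_imp_bounded by (metis bounded_pos imageI)
  have lip: "\<bar>b s - b t\<bar> \<le> B * \<bar>s - t\<bar>" if "s \<in> {0..1}" "t \<in> {0..1}" for s t
  proof -
    have "norm (b s - b t) \<le> B * norm (s - t)"
      by (rule field_differentiable_bound[where S = "{0..1}" and f' = b'])
        (use b'(1) B that in \<open>auto intro: has_vector_derivative_at_within
          simp: has_real_derivative_iff_has_vector_derivative\<close>)
    then show ?thesis by simp
  qed
  have "\<bar>b ((norm z)\<^sup>2) - b ((norm w)\<^sup>2)\<bar> \<le> (2 * B) * norm (z - w)" for z w :: 'a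
  proof -
    \<comment> \<open>Truncating the norms at 1 changes no value of \<open>b\<close>, which vanishes
      from 1 on. It brings the arguments into the interval where \<open>lip\<close> holds and bounds
      the factor \<open>m + n\<close> by 2.\<close>
    define m n where "m = min 1 (norm z)" and "n = min 1 (norm w)"
    have mn: "0 \<le> m" "m \<le> 1" "0 \<le> n" "n \<le> 1" by (auto simp: m_def n_def)
    have eq: "b ((norm x)\<^sup>2) = b ((min 1 (norm x))\<^sup>2)" for x :: 'a
      using b1 by (cases "norm x \<le> 1") (auto simp: min_def)
    have "\<bar>m - n\<bar> \<le> \<bar>norm z - norm w\<bar>" by (auto simp: m_def n_def)
    also have "\<dots> \<le> norm (z - w)" by (rule norm_triangle_ineq3)
    finally have d: "\<bar>m - n\<bar> \<le> norm (z - w)" .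
    have "\<bar>b (m\<^sup>2) - b (n\<^sup>2)\<bar> \<le> B * \<bar>m\<^sup>2 - n\<^sup>2\<bar>"
      using mn by (intro lip) (auto simp: power_le_one)
    also have "\<bar>m\<^sup>2 - n\<^sup>2\<bar> = (m + n) * \<bar>m - n\<bar>"
      using mn by (simp add: square_diff_square_factored power2_eq_square abs_mult)
    also have "\<dots> \<le> 2 * norm (z - w)" using mn d by (intro mult_mono) auto
    finally show ?thesis using B unfolding eq[of z] eq[of w] m_def n_def by (simp add: mult_left_mono)
  qed
  then show thesis using that[of b "2 * B"] smooth b0 b1 B by auto
qed

subsection \<open>Pushes and smooth curves\<close>

text \<open>Smoothness is stated through the effect on curves, so derivatives are only ever taken in
  one real variable. The lower Lipschitz bound gives injectivity and keeps velocities from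
  vanishing. All three conditions survive composition.\<close>

definition pushes_within :: "'a::euclidean_space set \<Rightarrow> ('a \<Rightarrow> 'a) \<Rightarrow> bool" where
  "pushes_within K \<phi> \<longleftrightarrow> (\<forall>z. z \<notin> K \<longrightarrow> \<phi> z = z) \<and>
     (\<exists>c>0. \<forall>z w. c * dist z w \<le> dist (\<phi> z) (\<phi> w)) \<and>
     (\<forall>n S g. differentiable_times n S g \<longrightarrow> differentiable_times n S (\<lambda>t. \<phi> (g t)))"

lemma pushes_within_outside: "pushes_within K \<phi> \<Longrightarrow> z \<notin> K \<Longrightarrow> \<phi> z = z"
  by (simp add: pushes_within_def)

lemma pushes_within_inj: "pushes_within K \<phi> \<Longrightarrow> \<phi> z = \<phi> w \<Longrightarrow> z = w"
  unfolding pushes_within_def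
  by (metis dist_eq_0_iff linorder_not_le mult_pos_pos zero_less_dist_iff)

text \<open>If the image left \<open>K\<close>, it would be a fixed point with the same image as
  \<open>z\<close>, hence equal to \<open>z\<close> by injectivity.\<close>

lemma pushes_within_image: "pushes_within K \<phi> \<Longrightarrow> z \<in> K \<Longrightarrow> \<phi> z \<in> K"
  by (metis pushes_within_inj pushes_within_outside)

lemma pushes_within_id: "pushes_within {} (\<lambda>z. z)"
  by (auto simp: pushes_within_def intro: exI[of _ 1])

lemma pushes_within_compose:
  assumes "pushes_within K \<phi>" "pushes_within K' \<psi>"
  shows "pushes_within (K \<union> K') (\<lambda>z. \<psi> (\<phi> z))"
proof -
  obtain c d where cd: "c > 0" "\<And>z w. c * dist z w \<le> dist (\<phi> z) (\<phi> w)"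
    "d > 0" "\<And>z w. d * dist z w \<le> dist (\<psi> z) (\<psi> w)"
    using assms unfolding pushes_within_def by blast
  have "(d * c) * dist z w \<le> dist (\<psi> (\<phi> z)) (\<psi> (\<phi> w))" for z w
  proof -
    have "d * (c * dist z w) \<le> d * dist (\<phi> z) (\<phi> w)"
      using cd(2)[of z w] cd(3) by simp
    also note cd(4)
    finally show ?thesis by (simp add: mult.assoc)
  qed
  then have "\<exists>c>0. \<forall>z w. c * dist z w \<le> dist (\<psi> (\<phi> z)) (\<psi> (\<phi> w))"
    using cd(1,3) by (intro exI[of _ "d * c"]) auto
  then show ?thesis using assms unfolding pushes_within_def by simp
qed

text \<open>Translate by \<open>v\<close>, weighted with a bump rescaled to radius \<open>r\<close>.
  The weight has Lipschitz constant \<open>L / r\<close>, so for \<open>norm v\<close> at most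
  \<open>r / (2 * L)\<close> the displacement is 1/2-Lipschitz and distances shrink at most by half.
  By scaling, \<open>k\<close> is independent of centre and radius.\<close>

lemma small_push:
  obtains k where "0 < k" "\<And>(x::'a::euclidean_space) v r. 0 < r \<Longrightarrow> norm v \<le> k * r \<Longrightarrow>
    \<exists>\<phi>. pushes_within (cball x r) \<phi> \<and> \<phi> x = x + v"
proof -
  obtain b :: "real \<Rightarrow> real" and L where b: "\<And>n S. differentiable_times n S b" "b 0 = 1"
    "\<And>u. 1 \<le> u \<Longrightarrow> b u = 0" "0 < L"
    "\<And>z w :: 'a. \<bar>b ((norm z)\<^sup>2) - b ((norm w)\<^sup>2)\<bar> \<le> L * norm (z - w)"
    using bump_function_exists[where 'a = 'a] by metis
  have "\<exists>\<phi>. pushes_within (cball x r) \<phi> \<and> \<phi> x = x + v"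
    if r: "0 < r" and v: "norm v \<le> 1 / (2 * L) * r" for x v :: 'a and r
  proof -
    define h where "h z = b ((norm ((1/r) *\<^sub>R (z - x)))\<^sup>2)" for z
    define \<phi> where "\<phi> z = z + h z *\<^sub>R v" for z
    have out: "\<phi> z = z" if "z \<notin> cball x r" for z
    proof -
      have "1 \<le> norm ((1/r) *\<^sub>R (z - x))"
        using that r unfolding norm_scaleR by (simp add: dist_norm norm_minus_commute field_simps)
      then have "h z = 0" unfolding h_def by (intro b(3) one_le_power)
      then show ?thesis by (simp add: \<phi>_def)
    qed
    have low: "(1/2) * dist z w \<le> dist (\<phi> z) (\<phi> w)" for z w
    proof -
      have "\<bar>h z - h w\<bar> \<le> L * norm ((1/r) *\<^sub>R (z - x) - (1/r) *\<^sub>R (w - x))"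
        unfolding h_def by (rule b(5))
      also have "(1/r) *\<^sub>R (z - x) - (1/r) *\<^sub>R (w - x) = (1/r) *\<^sub>R (z - w)"
        by (simp add: algebra_simps)
      finally have hl: "\<bar>h z - h w\<bar> \<le> L / r * dist z w" using r by (simp add: dist_norm)
      have "norm ((h z - h w) *\<^sub>R v) \<le> (L / r * dist z w) * (1 / (2 * L) * r)"
        unfolding norm_scaleR using hl v b(4) r by (intro mult_mono) auto
      also have "\<dots> = (1/2) * dist z w" using b(4) r by (simp add: field_simps)
      finally have "norm ((h z - h w) *\<^sub>R v) \<le> (1/2) * dist z w" .
      moreover have "\<phi> z - \<phi> w = (z - w) + (h z - h w) *\<^sub>R v"
        by (simp add: \<phi>_def algebra_simps)
      ultimately show ?thesis
        using norm_diff_ineq[of "z - w" "(h z - h w) *\<^sub>R v"] by (simp add: dist_norm)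
    qed
    have sm: "differentiable_times n S (\<lambda>t. \<phi> (g t))" if g: "differentiable_times n S g" for n S and g :: "real \<Rightarrow> 'a"
    proof -
      have gx: "differentiable_times n S (\<lambda>t. (1/r) *\<^sub>R (g t + - x))"
        by (intro differentiable_times_bilinear[OF bounded_bilinear_scaleR] differentiable_times_add
            differentiable_times_const g)
      have "differentiable_times n S (\<lambda>t. ((1/r) *\<^sub>R (g t + - x)) \<bullet> ((1/r) *\<^sub>R (g t + - x)))"
        by (rule differentiable_times_bilinear[OF bounded_bilinear_inner gx gx])
      then have "differentiable_times n S (\<lambda>t. h (g t))"
        unfolding h_def power2_norm_eq_inner diff_conv_add_uminus
        by (rule differentiable_times_compose[OF _ b(1)[of n UNIV]]) simp
      then show ?thesis unfolding \<phi>_def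
        by (intro differentiable_times_bilinear[OF bounded_bilinear_scaleR] differentiable_times_add
            differentiable_times_const g)
    qed
    have "pushes_within (cball x r) \<phi>"
      unfolding pushes_within_def using out low sm by (auto intro!: exI[of _ "1/2"])
    moreover have "\<phi> x = x + v" by (simp add: \<phi>_def h_def b(2))
    ultimately show ?thesis by blast
  qed
  then show thesis using that[of "1 / (2 * L)"] b(4) by auto
qed

text \<open>Near any point of \<open>U\<close> small pushes carry each point to each other one, so
  being reachable from \<open>x\<close> is a locally constant property on the connected set
  \<open>U\<close>.\<close>

lemma push_transitive:
  fixes U :: "'a::euclidean_space set"
  assumes U: "open U" "connected U" and xy: "x \<in> U" "y \<in> U"
  shows "\<exists>K \<phi>. compact K \<and> K \<subseteq> U \<and> pushes_within K \<phi> \<and> \<phi> x = y"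
proof -
  obtain k where k: "0 < k" "\<And>(x::'a) v r. 0 < r \<Longrightarrow> norm v \<le> k * r \<Longrightarrow>
    \<exists>\<phi>. pushes_within (cball x r) \<phi> \<and> \<phi> x = x + v"
    using small_push[where 'a = 'a] by metis
  show ?thesis
  proof (rule connected_induction_simple[where S = U and a = x and b = y and
      P = "\<lambda>y. \<exists>K \<phi>. compact K \<and> K \<subseteq> U \<and> pushes_within K \<phi> \<and> \<phi> x = y"])
    show "\<exists>K \<phi>. compact K \<and> K \<subseteq> U \<and> pushes_within K \<phi> \<and> \<phi> x = x"
      using pushes_within_id by (metis compact_empty empty_subsetI)
  next
    fix a assume "a \<in> U"
    then obtain R where R: "0 < R" "cball a R \<subseteq> U" using U(1) open_contains_cball by blast
    \<comment> \<open>Two points of \<open>ball a s\<close> are less than \<open>2 * s\<close>,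
      hence less than \<open>k * (R/2)\<close>, apart, so a push of radius \<open>R/2\<close> joins
      them; \<open>s\<close> being at most \<open>R/2\<close> keeps its support inside
      \<open>cball a R\<close>.\<close>
    define s where "s = min (R/2) (k * R / 4)"
    have s: "0 < s" "s \<le> R/2" "s \<le> k * R / 4" using R k by (auto simp: s_def)
    show "\<exists>T. openin (top_of_set U) T \<and> a \<in> T \<and>
          (\<forall>z\<in>T. \<forall>w\<in>T. (\<exists>K \<phi>. compact K \<and> K \<subseteq> U \<and> pushes_within K \<phi> \<and> \<phi> x = z) \<longrightarrow>
             (\<exists>K \<phi>. compact K \<and> K \<subseteq> U \<and> pushes_within K \<phi> \<and> \<phi> x = w))"
    proof (rule exI[of _ "ball a s"], intro conjI ballI impI)
      have "ball a s \<subseteq> U" using R s by (force simp: subset_iff)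
      then show "openin (top_of_set U) (ball a s)" using U(1) by (simp add: openin_open_eq)
      show "a \<in> ball a s" using s by simp
    next
      fix z w assume zw: "z \<in> ball a s" "w \<in> ball a s"
        and "\<exists>K \<phi>. compact K \<and> K \<subseteq> U \<and> pushes_within K \<phi> \<and> \<phi> x = z"
      then obtain K \<phi> where K: "compact K" "K \<subseteq> U" "pushes_within K \<phi>" "\<phi> x = z" by blast
      have "dist z w < 2 * s" using zw dist_triangle[of z w a] by (simp add: dist_commute)
      then have "norm (w - z) \<le> k * (R/2)" using s by (simp add: dist_norm norm_minus_commute)
      then obtain \<psi> where \<psi>: "pushes_within (cball z (R/2)) \<psi>" "\<psi> z = w"
        using k(2)[of "R/2" "w - z" z] R by auto
      have "cball z (R/2) \<subseteq> cball a R"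
      proof
        fix y assume "y \<in> cball z (R/2)"
        then show "y \<in> cball a R" using dist_triangle[of a y z] zw s by simp
      qed
      then have "K \<union> cball z (R/2) \<subseteq> U" using K R by blast
      moreover have "compact (K \<union> cball z (R/2))" using K by (simp add: compact_Un)
      ultimately show "\<exists>K \<phi>. compact K \<and> K \<subseteq> U \<and> pushes_within K \<phi> \<and> \<phi> x = w"
        using pushes_within_compose[OF K(3) \<psi>(1)] K(4) \<psi>(2)
        by (intro exI[of _ "K \<union> cball z (R/2)"] exI[of _ "\<lambda>z. \<psi> (\<phi> z)"]) auto
    qed
  qed (use assms in auto)
qed

text \<open>If the pushed curve had velocity 0, its increments would be of smaller order than those
  of the parameter. By the lower Lipschitz bound the same would hold for \<open>g\<close>, forcing
  \<open>g' = 0\<close>.\<close>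

lemma push_preserves_nonzero_derivative:
  assumes \<phi>: "pushes_within K \<phi>" and g: "(g has_vector_derivative g') (at t)" "g' \<noteq> 0"
    and d: "((\<lambda>t. \<phi> (g t)) has_vector_derivative d) (at t)"
  shows "d \<noteq> 0"
proof
  assume "d = 0"
  obtain c where c: "c > 0" "\<And>z w. c * dist z w \<le> dist (\<phi> z) (\<phi> w)"
    using \<phi> unfolding pushes_within_def by blast
  have d0: "((\<lambda>t. \<phi> (g t)) has_derivative (\<lambda>x. 0)) (at t)"
    using d \<open>d = 0\<close> by (simp add: has_vector_derivative_def)
  have "(g has_derivative (\<lambda>x. 0)) (at t)"
    unfolding has_derivative_at_alt
  proof (intro conjI allI impI)
    fix e :: real assume "0 < e"
    then have "0 < c * e" using c by simp
    then obtain r where r: "r > 0" "\<And>y. norm (y - t) < r \<Longrightarrow> norm (\<phi> (g y) - \<phi> (g t) - 0) \<le> c * e * norm (y - t)"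
      using d0 unfolding has_derivative_at_alt by blast
    have "norm (g y - g t - 0) \<le> e * norm (y - t)" if "norm (y - t) < r" for y
    proof -
      have "c * norm (g y - g t) \<le> c * (e * norm (y - t))"
        using c(2)[of "g y" "g t"] r(2)[OF that] by (simp add: dist_norm mult.assoc)
      then show ?thesis using c(1) by simp
    qed
    then show "\<exists>d>0. \<forall>y. norm (y - t) < d \<longrightarrow> norm (g y - g t - 0) \<le> e * norm (y - t)"
      using r(1) by blast
  qed simp
  then have "(g has_vector_derivative 0) (at t)" by (simp add: has_vector_derivative_def)
  then show False using g vector_derivative_unique_at by blast
qed

section \<open>Regular injective smooth curves\<close>

definition smooth_curve_on :: "real set \<Rightarrow> (real \<Rightarrow> 'a::euclidean_space) \<Rightarrow> bool" where
  "smooth_curve_on S g \<longleftrightarrow> (\<forall>n. differentiable_times n S g) \<and> inj_on g S \<and>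
     (\<forall>t\<in>S. vector_derivative g (at t) \<noteq> 0)"

lemma smooth_curve_on_has_vector_derivative:
  assumes "smooth_curve_on S g" "t \<in> S"
  shows "(g has_vector_derivative vector_derivative g (at t)) (at t)"
proof -
  have "differentiable_times 1 S g" using assms(1) unfolding smooth_curve_on_def by blast
  then show ?thesis using assms(2) by (auto simp: vector_derivative_at)
qed

lemma smooth_curve_on_subset:
  "smooth_curve_on S g \<Longrightarrow> T \<subseteq> S \<Longrightarrow> smooth_curve_on T g"
  unfolding smooth_curve_on_def by (meson differentiable_times_subset inj_on_subset subsetD)

lemma smooth_curve_on_cong:
  assumes g: "smooth_curve_on S g" and S: "open S" and eq: "\<And>t. t \<in> S \<Longrightarrow> g t = h t"
  shows "smooth_curve_on S h"
  unfolding smooth_curve_on_def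
proof (intro conjI allI ballI)
  fix n
  have "differentiable_times n S g" using g by (simp add: smooth_curve_on_def)
  then show "differentiable_times n S h" using S eq by (rule differentiable_times_cong)
next
  show "inj_on h S" using g eq inj_on_cong[of S g h] by (simp add: smooth_curve_on_def)
next
  fix t assume t: "t \<in> S"
  have "(h has_vector_derivative vector_derivative g (at t)) (at t)"
    by (rule has_vector_derivative_transform_within_open
        [OF smooth_curve_on_has_vector_derivative[OF g t] S t eq])
  then show "vector_derivative h (at t) \<noteq> 0"
    using g t by (simp add: smooth_curve_on_def vector_derivative_at)
qed

lemma smooth_curve_on_push:
  assumes "smooth_curve_on S g" "pushes_within K \<phi>"
  shows "smooth_curve_on S (\<lambda>t. \<phi> (g t))"
  unfolding smooth_curve_on_def
proof (intro conjI allI ballI)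
  show 1: "differentiable_times n S (\<lambda>t. \<phi> (g t))" for n
    using assms unfolding smooth_curve_on_def pushes_within_def by blast
  show "inj_on (\<lambda>t. \<phi> (g t)) S"
    using assms unfolding smooth_curve_on_def inj_on_def by (metis pushes_within_inj)
  fix t assume t: "t \<in> S"
  have "((\<lambda>t. \<phi> (g t)) has_vector_derivative vector_derivative (\<lambda>t. \<phi> (g t)) (at t)) (at t)"
    using 1[of 1] t by (auto simp: vector_derivative_at)
  then show "vector_derivative (\<lambda>t. \<phi> (g t)) (at t) \<noteq> 0"
    using push_preserves_nonzero_derivative[OF assms(2) smooth_curve_on_has_vector_derivative[OF assms(1) t]]
      assms(1) t unfolding smooth_curve_on_def by blast
qed

lemma smooth_curve_on_continuous:
  "smooth_curve_on S g \<Longrightarrow> continuous_on S g"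
  by (meson continuous_at_imp_continuous_on has_vector_derivative_continuous
      smooth_curve_on_has_vector_derivative)

lemma smooth_curve_on_affine:
  fixes g :: "real \<Rightarrow> 'a::euclidean_space"
  assumes g: "smooth_curve_on T g" and c: "c \<noteq> 0" and S: "(\<lambda>t. c * t + d) ` S \<subseteq> T"
  shows "smooth_curve_on S (\<lambda>t. g (c * t + d))"
  unfolding smooth_curve_on_def
proof (intro conjI allI ballI)
  show "differentiable_times n S (\<lambda>t. g (c * t + d))" for n
  proof -
    have "differentiable_times n S (\<lambda>t. c * t)"
      by (rule differentiable_times_bilinear[OF bounded_bilinear_mult
          differentiable_times_const differentiable_times_ident])
    then have A: "differentiable_times n S (\<lambda>t. c * t + d)"
      by (rule differentiable_times_add[OF _ differentiable_times_const])
    have B: "differentiable_times n T g" using g by (simp add: smooth_curve_on_def)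
    show ?thesis using differentiable_times_compose[OF A B S] .
  qed
  show "inj_on (\<lambda>t. g (c * t + d)) S"
  proof (rule inj_onI)
    fix x y assume "x \<in> S" "y \<in> S" "g (c * x + d) = g (c * y + d)"
    then have "c * x + d = c * y + d"
      using g S inj_onD[of g T "c * x + d" "c * y + d"] by (auto simp: smooth_curve_on_def)
    then show "x = y" using c by simp
  qed
  fix t assume t: "t \<in> S"
  define v where "v = vector_derivative g (at (c * t + d))"
  have ct: "c * t + d \<in> T" using S t by blast
  have "(g has_vector_derivative v) (at (c * t + d))"
    unfolding v_def by (rule smooth_curve_on_has_vector_derivative[OF g ct])
  moreover have "((\<lambda>t. c * t + d) has_vector_derivative c) (at t)"
    by (auto intro!: derivative_eq_intros)
  ultimately have "((\<lambda>t. g (c * t + d)) has_vector_derivative c *\<^sub>R v) (at t)"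
    using vector_diff_chain_at[of "\<lambda>t. c * t + d" c t g v] by (simp add: o_def)
  then have "vector_derivative (\<lambda>t. g (c * t + d)) (at t) = c *\<^sub>R v" by (rule vector_derivative_at)
  moreover have "v \<noteq> 0" using g ct by (auto simp: smooth_curve_on_def v_def)
  ultimately show "vector_derivative (\<lambda>t. g (c * t + d)) (at t) \<noteq> 0" using c by simp
qed

lemma smooth_curve_on_line:
  fixes a v :: "'a::euclidean_space"
  assumes "v \<noteq> 0"
  shows "smooth_curve_on S (\<lambda>t. a + t *\<^sub>R v)"
  unfolding smooth_curve_on_def
proof (intro conjI allI ballI)
  show "differentiable_times n S (\<lambda>t. a + t *\<^sub>R v)" for n
    by (intro differentiable_times_add differentiable_times_const differentiable_times_ident
        differentiable_times_bilinear[OF bounded_bilinear_scaleR])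
  show "inj_on (\<lambda>t. a + t *\<^sub>R v) S" using assms by (auto simp: inj_on_def)
  fix t
  have "((\<lambda>t. a + t *\<^sub>R v) has_vector_derivative v) (at t)"
    by (auto intro!: derivative_eq_intros)
  then show "vector_derivative (\<lambda>t. a + t *\<^sub>R v) (at t) \<noteq> 0"
    using assms by (simp add: vector_derivative_at)
qed

subsection \<open>Limits of pushed curves\<close>

text \<open>The curve is cut at the first parameter \<open>t\<close> whose image is moved for ever.
  Before \<open>t\<close> each point stops moving, together with a neighbourhood, so the limit is
  locally one of the curves \<open>G k\<close>. The parameter \<open>b\<close> follows the sequence
  \<open>e\<close> and never stops, so \<open>t\<close> exists; up to \<open>a'\<close> nothing
  moves at all.\<close>

lemma limit_of_pushes:
  fixes p :: "'a::euclidean_space"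
  assumes push: "\<And>k. pushes_within (K k) (\<phi> k)" and clK: "\<And>k. closed (K k)"
    and KL: "\<And>k. K k \<subseteq> ball p (r k) - L" and pL: "p \<in> L"
    and r: "decseq r" "r \<longlonglongrightarrow> 0"
    and e: "\<And>k. \<phi> k (e k) = e (Suc k)" "e \<longlonglongrightarrow> p"
    and g: "smooth_curve_on {a<..<c} g" "g b = e 0" "\<And>x. x \<in> {a<..<c} \<Longrightarrow> g x \<notin> L"
    and abc: "a < a'" "a' \<le> b" "b < c" "\<And>x. x \<in> {a<..a'} \<Longrightarrow> g x \<notin> ball p (r 0)"
  obtains h t where "a' < t" "t \<le> b" "smooth_curve_on {a<..<t} h" "(h \<longlongrightarrow> p) (at_left t)"
    "\<And>x. x \<in> {a<..<t} \<Longrightarrow> h x \<notin> L"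
    "\<And>x. x \<in> {a<..<t} \<Longrightarrow> g x \<notin> ball p (r 0) \<Longrightarrow> h x = g x"
    "\<And>x. x \<in> {a<..<t} \<Longrightarrow> g x \<in> ball p (r 0) \<Longrightarrow> h x \<in> ball p (r 0)"
proof -
  define G where "G = rec_nat g (\<lambda>k f x. \<phi> k (f x))"
  have G0: "G 0 = g" and GSuc: "G (Suc k) = (\<lambda>x. \<phi> k (G k x))" for k
    by (auto simp: G_def)
  have out: "\<phi> k z = z" if "z \<notin> K k" for k z
    using push pushes_within_outside that by blast
  have inK: "\<phi> k z \<in> K k" if "z \<in> K k" for k z
    using push pushes_within_image that by blast
  have rle: "r j \<le> r i" if "i \<le> j" for i j using r(1) that by (simp add: decseq_def)
  \<comment> \<open>A push with index \<open>i \<ge> j\<close> preserves its support, which lies in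
    the \<open>j\<close>-th ball, and fixes everything else, so no image escapes from that ball
    after stage \<open>j\<close>.\<close>
  have stay: "G i x \<in> ball p (r j)" if "G j x \<in> ball p (r j)" "j \<le> i" for i j x
    using that(2)
  proof (induction rule: dec_induct)
    case (step i)
    show ?case
    proof (cases "G i x \<in> K i")
      case True
      then have "\<phi> i (G i x) \<in> ball p (r i)" using inK KL by blast
      then show ?thesis using rle[OF step.hyps(1)] by (simp add: GSuc)
    next
      case False
      then show ?thesis using step.IH out by (simp add: GSuc)
    qed
  qed (use that in auto)
  have GL: "G k x \<notin> L" if "x \<in> {a<..<c}" for k x
  proof (induction k)
    case (Suc k)
    then show ?case using inK out KL unfolding GSuc by (metis DiffE subsetD)
  qed (use g(3) that G0 in auto)
  have smG: "smooth_curve_on {a<..<c} (G k)" for k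
  proof (induction k)
    case (Suc k)
    then show ?case unfolding GSuc
      by (rule smooth_curve_on_push[OF _ push])
  qed (simp add: G0 g)
  have contG: "continuous_on {a<..<c} (G k)" for k
    using smG smooth_curve_on_continuous by blast

  define stop where "stop k x \<longleftrightarrow> (\<forall>j\<ge>k. G j x \<notin> K j)" for k x
  have stopG: "G j x = G k x" if "stop k x" "k \<le> j" for j k x
    using that(2)
  proof (induction rule: dec_induct)
    case (step i)
    then have "G i x \<notin> K i" using that(1) unfolding stop_def by blast
    then show ?case using step.IH out by (simp add: GSuc)
  qed simp
  have stop_mono: "stop j x" if "stop k x" "k \<le> j" for j k x
    using that by (auto simp: stop_def)
  have stop_out: "stop 0 x" if "g x \<notin> ball p (r 0)" for x
  proof -
    have *: "g x \<notin> K j" for j using that KL[of j] rle[of 0 j] by auto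
    have "G j x = g x" for j
    proof (induction j)
      case (Suc j)
      then show ?case using out * by (simp add: GSuc)
    qed (simp add: G0)
    then show ?thesis using * by (simp add: stop_def)
  qed
  \<comment> \<open>The stopped image \<open>z\<close> is not \<open>p\<close>. With
    \<open>d\<close> half their distance, supports of radius below \<open>d\<close> about
    \<open>p\<close> cannot reach the \<open>d\<close>-ball about \<open>z\<close>. The finitely
    many remaining ones are closed and miss \<open>z\<close>, so a neighbourhood of \<open>z\<close>
    is never touched from stage \<open>k\<close> on.\<close>
  have stop_open: "\<exists>T. open T \<and> x \<in> T \<and> T \<subseteq> {a<..<c} \<and> (\<forall>y\<in>T. stop k y)"
    if x: "x \<in> {a<..<c}" and st: "stop k x" for k x
  proof -
    define z where "z = G k x"
    have zK: "z \<notin> K j" if "k \<le> j" for j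
      using stopG[OF st that] st that by (auto simp: stop_def z_def)
    have "z \<noteq> p" using GL[OF x, of k] pL by (auto simp: z_def)
    define d where "d = dist z p / 2"
    have d: "0 < d" using \<open>z \<noteq> p\<close> by (simp add: d_def)
    obtain J where J: "\<And>j. J \<le> j \<Longrightarrow> r j < d"
      using order_tendstoD(2)[OF r(2) d] unfolding eventually_sequentially by blast
    define N where "N = ball z d \<inter> (\<Inter>j\<in>{k..<J}. - K j)"
    have oN: "open N" unfolding N_def using clK by (intro open_Int open_INT) auto
    have zN: "z \<in> N" using zK d by (simp add: N_def)
    have NK: "w \<notin> K j" if w: "w \<in> N" and "k \<le> j" for w j
    proof (cases "j < J")
      case True
      then show ?thesis using that by (simp add: N_def)
    next
      case False
      show ?thesis
      proof
        assume "w \<in> K j"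
        then have "dist p w < d" using KL J[of j] False by fastforce
        moreover have "dist z w < d" using w by (simp add: N_def)
        moreover have "dist z p \<le> dist z w + dist p w" by (rule dist_triangle2)
        ultimately show False by (simp add: d_def)
      qed
    qed
    define T where "T = {a<..<c} \<inter> G k -` N"
    have "open T" unfolding T_def
      by (rule continuous_open_preimage[OF contG open_greaterThanLessThan oN])
    moreover have "x \<in> T" using x zN by (simp add: T_def z_def)
    moreover have "stop k y" if "y \<in> T" for y
    proof -
      have yN: "G k y \<in> N" using that by (simp add: T_def)
      have Gy: "G j y = G k y" if "k \<le> j" for j
        using that
      proof (induction rule: dec_induct)
        case (step i)
        then show ?case using NK[OF yN] out by (simp add: GSuc)
      qed simp
      show ?thesis unfolding stop_def
      proof (intro allI impI)
        fix j assume "k \<le> j"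
        then show "G j y \<notin> K j" using NK[OF yN] by (subst Gy)
      qed
    qed
    ultimately show ?thesis by (intro exI[of _ T]) (auto simp: T_def)
  qed

  \<comment> \<open>The parameters in question that move for ever. They form a closed set because
    stopping is an open condition.\<close>
  define F where "F = {x \<in> {a'..b}. \<forall>k. \<not> stop k x}"
  have clF: "closed F"
  proof -
    define Z where "Z = \<Union> {T. open T \<and> T \<subseteq> {a<..<c} \<and> (\<exists>k. \<forall>y\<in>T. stop k y)}"
    have "open Z" unfolding Z_def by (intro open_Union) auto
    moreover have "F = {a'..b} - Z"
    proof (intro equalityI subsetI)
      fix x assume x: "x \<in> {a'..b} - Z"
      then have xac: "x \<in> {a<..<c}" using abc by auto
      have False if k: "stop k x" for k
      proof -
        obtain T where "open T" "x \<in> T" "T \<subseteq> {a<..<c}" "\<forall>y\<in>T. stop k y"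
          using stop_open[OF xac k] by metis
        then have "x \<in> Z" unfolding Z_def by blast
        then show False using x by simp
      qed
      then show "x \<in> F" using x by (auto simp: F_def)
    qed (auto simp: F_def Z_def)
    ultimately show ?thesis by (simp add: closed_Diff)
  qed
  have Gb: "G k b = e k" for k
    by (induction k) (use g e in \<open>auto simp: G0 GSuc\<close>)
  \<comment> \<open>If \<open>b\<close> stopped, \<open>e\<close> would be eventually constant with
    value \<open>p\<close>, but its terms lie off \<open>L\<close> and \<open>p\<close> lies in
    \<open>L\<close>.\<close>
  have "b \<in> F"
  proof -
    have False if "stop k b" for k
    proof -
      have "e j = e k" if "k \<le> j" for j using stopG[OF \<open>stop k b\<close> that] by (simp add: Gb)
      then have "\<forall>\<^sub>F j in sequentially. e k = e j" unfolding eventually_sequentially by metis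
      then have "e \<longlonglongrightarrow> e k" by (rule Lim_transform_eventually[OF tendsto_const])
      then have "e k = p" using e(2) LIMSEQ_unique by blast
      then show False using GL[of b k] abc pL Gb by simp
    qed
    then show ?thesis using abc by (auto simp: F_def)
  qed
  define t where "t = Inf F"
  have bdd: "bdd_below F" by (auto simp: F_def intro!: bdd_belowI[of _ a'])
  have tF: "t \<in> F" unfolding t_def using clF \<open>b \<in> F\<close> bdd by (intro closed_contains_Inf) auto
  have "a' \<notin> F" using stop_out[of a'] abc by (auto simp: F_def)
  then have at: "a' < t" using tF by (cases "a' = t") (auto simp: F_def)
  have tb: "t \<le> b" using tF by (auto simp: F_def)
  have stops: "\<exists>k. stop k x" if "x \<in> {a<..<t}" for x
  proof (cases "x \<le> a'")
    case True
    then show ?thesis using stop_out[of x] abc that by auto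
  next
    case False
    have "x \<notin> F" using cInf_lower[OF _ bdd, of x] that by (auto simp: t_def)
    then show ?thesis using False that tb by (auto simp: F_def)
  qed
  have sub: "{a<..<t} \<subseteq> {a<..<c}" using tb abc by auto

  \<comment> \<open>Any stage at which \<open>x\<close> has stopped gives the same value, as
    \<open>hG\<close> shows; the least one is only a choice.\<close>
  define h where "h x = G (LEAST k. stop k x) x" for x
  have hG: "h x = G k x" if "stop k x" for k x
    unfolding h_def using that by (metis LeastI Least_le stopG)
  have loc: "\<exists>T k. open T \<and> x \<in> T \<and> T \<subseteq> {a<..<c} \<and> (\<forall>y\<in>T. h y = G k y)" if "x \<in> {a<..<t}" for x
  proof -
    obtain k where "stop k x" using stops[OF \<open>x \<in> {a<..<t}\<close>] by blast
    then obtain T where "open T" "x \<in> T" "T \<subseteq> {a<..<c}" "\<forall>y\<in>T. stop k y"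
      using stop_open[of x k] subsetD[OF sub \<open>x \<in> {a<..<t}\<close>] by metis
    then show ?thesis using hG by (intro exI[of _ T] exI[of _ k]) auto
  qed
  have smT: "\<exists>T. open T \<and> x \<in> T \<and> smooth_curve_on T h" if x: "x \<in> {a<..<t}" for x
  proof -
    obtain T k where T: "open T" "x \<in> T" "T \<subseteq> {a<..<c}" "\<And>y. y \<in> T \<Longrightarrow> G k y = h y"
      using loc[OF x] by metis
    then show ?thesis
      using smooth_curve_on_cong[OF smooth_curve_on_subset[OF smG T(3)] T(1) T(4)] by blast
  qed
  have smh: "smooth_curve_on {a<..<t} h"
    unfolding smooth_curve_on_def
  proof (intro conjI allI ballI)
    show "differentiable_times n {a<..<t} h" for n
    proof (rule differentiable_times_local[OF open_greaterThanLessThan])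
      fix x assume "x \<in> {a<..<t}"
      then show "\<exists>T. open T \<and> x \<in> T \<and> differentiable_times n T h"
        using smT unfolding smooth_curve_on_def by meson
    qed
  next
    show "inj_on h {a<..<t}"
    proof (rule inj_onI)
      fix x y assume xy: "x \<in> {a<..<t}" "y \<in> {a<..<t}" "h x = h y"
      \<comment> \<open>Both points have stopped at stage \<open>max i j\<close>, so injectivity of
        that single curve decides.\<close>
      obtain i j where ij: "stop i x" "stop j y" using stops xy by blast
      have "h x = G (max i j) x" "h y = G (max i j) y"
        using hG stop_mono[OF ij(1)] stop_mono[OF ij(2)] by auto
      then have "G (max i j) x = G (max i j) y" using xy(3) by simp
      moreover have "inj_on (G (max i j)) {a<..<c}" using smG unfolding smooth_curve_on_def by blast
      ultimately show "x = y" using xy(1,2) sub inj_onD by (metis subsetD)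
    qed
  next
    fix x assume "x \<in> {a<..<t}"
    then show "vector_derivative h (at x) \<noteq> 0"
      using smT unfolding smooth_curve_on_def by blast
  qed
  \<comment> \<open>Since \<open>t\<close> never stops, \<open>G j t\<close> lies in
    \<open>K j\<close>, hence in the \<open>j\<close>-th ball, for some arbitrarily late
    \<open>j\<close>. By continuity of \<open>G j\<close> so do the images of nearby parameters, and
    by \<open>stay\<close> their final positions remain there.\<close>
  have lim: "(h \<longlongrightarrow> p) (at_left t)"
  proof (rule tendstoI)
    fix \<epsilon> :: real assume "0 < \<epsilon>"
    then obtain J where J: "\<And>j. J \<le> j \<Longrightarrow> r j < \<epsilon>"
      using order_tendstoD(2)[OF r(2)] unfolding eventually_sequentially by blast
    have "\<not> stop J t" using tF by (simp add: F_def)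
    then obtain j where j: "J \<le> j" "G j t \<in> K j" by (auto simp: stop_def)
    have tac: "t \<in> {a<..<c}" using at tb abc by auto
    have "isCont (G j) t" 
      using contG[of j] tac continuous_on_eq_continuous_at[of "{a<..<c}" "G j"] by simp
    then have "(G j \<longlongrightarrow> G j t) (at_left t)"
      by (simp add: isCont_def filterlim_at_split)
    moreover have "G j t \<in> ball p (r j)" using j KL by blast
    ultimately have "\<forall>\<^sub>F x in at_left t. G j x \<in> ball p (r j)"
      using topological_tendstoD[OF _ open_ball] by blast
    moreover have "\<forall>\<^sub>F x in at_left t. x \<in> {a<..<t}"
      using at abc by (intro eventually_at_leftI[of a]) auto
    ultimately show "\<forall>\<^sub>F x in at_left t. dist (h x) p < \<epsilon>"
    proof eventually_elim
      case (elim x)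
      obtain k where "stop k x" using stops elim by blast
      then have "h x = G (max k j) x" 
        using hG[of "max k j" x] stop_mono[of k x "max k j"] by simp
      moreover have "G (max k j) x \<in> ball p (r j)" using stay[of j x "max k j"] elim by simp
      ultimately show ?case using J[OF j(1)] by (simp add: dist_commute)
    qed
  qed
  show thesis
  proof (rule that[OF at tb smh lim])
    fix x assume x: "x \<in> {a<..<t}"
    then obtain k where k: "stop k x" using stops by blast
    show "h x \<notin> L" using hG[OF k] GL sub x by auto
    show "h x = g x" if "g x \<notin> ball p (r 0)" using hG[OF stop_out[OF that]] G0 by simp
    show "h x \<in> ball p (r 0)" if "g x \<in> ball p (r 0)"
      using hG[OF k] stay[of 0 x k] that G0 by simp
  qed
qed

section \<open>Redirecting a curve to an endpoint of the arc\<close>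

lemma push_sequence_to_arc_start:
  fixes \<gamma> :: "real \<Rightarrow> 'a::euclidean_space"
  assumes dim: "2 \<le> DIM('a)" and \<gamma>: "arc \<gamma>" and R: "0 < R"
  defines "p \<equiv> pathstart \<gamma>" and "L \<equiv> path_image \<gamma>" and "r \<equiv> \<lambda>k. R / (real k + 1)"
  obtains K \<phi> e where "\<And>k. pushes_within (K k) (\<phi> k)" "\<And>k. closed (K k)"
    "\<And>k. K k \<subseteq> ball p (r k) - L" "\<And>k. \<phi> k (e k) = e (Suc k)" "\<And>k. e k \<in> ball p (r k) - L"
proof -
  have r: "0 < r k" for k using R by (simp add: r_def)
  have "\<forall>k. \<exists>d>0. \<forall>x y. x \<in> ball p d - L \<longrightarrow> y \<in> ball p d - L \<longrightarrow> connected_component (ball p (r k) - L) x y"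
    using arc_complement_locally_connected_at_start[OF dim \<gamma> r] unfolding p_def L_def by blast
  then obtain d where d: "\<And>k. d k > 0"
    "\<And>k x y. x \<in> ball p (d k) - L \<Longrightarrow> y \<in> ball p (d k) - L \<Longrightarrow> connected_component (ball p (r k) - L) x y"
    by metis
  \<comment> \<open>Taking the minimum over all indices up to \<open>k\<close> puts
    \<open>e (Suc k)\<close> into the ball of radius \<open>d k\<close> as well, so consecutive
    points can be joined inside the \<open>k\<close>-th ball off \<open>L\<close>.\<close>
  define m where "m k = min (r k) (Min (d ` {..k}))" for k
  have m: "0 < m k" "m k \<le> r k" "\<And>j. j \<le> k \<Longrightarrow> m k \<le> d j" for k
    using d(1) r by (auto simp: m_def intro: min.coboundedI2)
  have "\<exists>z. z \<in> ball p (m k) - L" for k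
  proof (rule ccontr)
    assume "\<nexists>z. z \<in> ball p (m k) - L"
    then have "ball p (m k) \<subseteq> interior L" by (intro interior_maximal) auto
    then show False using interior_arc_image_empty[OF dim \<gamma>] m(1)[of k] unfolding L_def by auto
  qed
  then obtain e where e: "\<And>k. e k \<in> ball p (m k) - L" by metis
  have clL: "closed L" unfolding L_def using \<gamma> by (simp add: closed_arc_image)
  have "\<exists>K \<phi>. pushes_within K \<phi> \<and> closed K \<and> K \<subseteq> ball p (r k) - L \<and> \<phi> (e k) = e (Suc k)" for k
  proof -
    \<comment> \<open>This component is open and connected and contains both points, so a push with
      compact support in it carries one to the other.\<close>
    define U where "U = connected_component_set (ball p (r k) - L) (e k)"
    have "e k \<in> ball p (d k) - L" "e (Suc k) \<in> ball p (d k) - L"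
      using e[of k] e[of "Suc k"] m(3)[of k k] m(3)[of k "Suc k"] by auto
    then have cc: "connected_component (ball p (r k) - L) (e k) (e (Suc k))" by (rule d(2))
    then have in_U: "e k \<in> U" "e (Suc k) \<in> U"
      unfolding U_def using connected_component_in connected_component_refl by fastforce+
    have "open U" unfolding U_def using clL by (intro open_connected_component) (simp add: open_Diff)
    then obtain K \<phi> where K: "compact K" "K \<subseteq> U" "pushes_within K \<phi>" "\<phi> (e k) = e (Suc k)"
      using push_transitive[of U, OF _ _ in_U] unfolding U_def using connected_connected_component by blast
    moreover have "U \<subseteq> ball p (r k) - L" unfolding U_def by (rule connected_component_subset)
    ultimately show ?thesis using compact_imp_closed by blast
  qed
  then obtain K \<phi> where "\<And>k. pushes_within (K k) (\<phi> k)" "\<And>k. closed (K k)"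
    "\<And>k. K k \<subseteq> ball p (r k) - L" "\<And>k. \<phi> k (e k) = e (Suc k)"
    by metis
  moreover have "e k \<in> ball p (r k) - L" for k using e[of k] m(2)[of k] by auto
  ultimately show thesis using that by blast
qed

text \<open>The target \<open>e\<close> depends only on the arc and \<open>R\<close> and is fixed
  before any curve is given, so that a curve can be built to pass through it. The new curve differs
  from the old one only inside the ball.\<close>

lemma smooth_curve_redirect_to_arc_start:
  fixes \<gamma> :: "real \<Rightarrow> 'a::euclidean_space"
  assumes dim: "2 \<le> DIM('a)" and \<gamma>: "arc \<gamma>" and R: "0 < R"
  obtains e where "e \<in> ball (pathstart \<gamma>) R - path_image \<gamma>"
    "\<And>g a a' b c. \<lbrakk>smooth_curve_on {a<..<c} g; g b = e; \<And>x. x \<in> {a<..<c} \<Longrightarrow> g x \<notin> path_image \<gamma>;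
       a < a'; a' \<le> b; b < c; \<And>x. x \<in> {a<..a'} \<Longrightarrow> g x \<notin> ball (pathstart \<gamma>) R\<rbrakk> \<Longrightarrow>
     \<exists>h t. a' < t \<and> t \<le> b \<and> smooth_curve_on {a<..<t} h \<and> (h \<longlongrightarrow> pathstart \<gamma>) (at_left t) \<and>
       (\<forall>x\<in>{a<..<t}. h x \<notin> path_image \<gamma> \<and>
          (if g x \<in> ball (pathstart \<gamma>) R then h x \<in> ball (pathstart \<gamma>) R else h x = g x))"
proof -
  define p where "p = pathstart \<gamma>"
  define r where "r = (\<lambda>k. R / (real k + 1))"
  obtain K \<phi> e where *: "\<And>k. pushes_within (K k) (\<phi> k)" "\<And>k. closed (K k)"
    "\<And>k. K k \<subseteq> ball p (r k) - path_image \<gamma>" "\<And>k. \<phi> k (e k) = e (Suc k)"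
    "\<And>k. e k \<in> ball p (r k) - path_image \<gamma>"
    using push_sequence_to_arc_start[OF dim \<gamma> R] unfolding p_def r_def by metis
  have r0: "r 0 = R" by (simp add: r_def)
  have dec: "decseq r" unfolding r_def decseq_def using R by (auto intro!: divide_left_mono)
  have "(\<lambda>k. R * inverse (real (Suc k))) \<longlonglongrightarrow> 0"
    by (intro tendsto_mult_right_zero LIMSEQ_inverse_real_of_nat)
  then have rlim: "r \<longlonglongrightarrow> 0" by (simp add: r_def divide_inverse add.commute)
  have elim: "e \<longlonglongrightarrow> p"
  proof (rule metric_tendsto_imp_tendsto[OF rlim])
    show "\<forall>\<^sub>F k in sequentially. dist (e k) p \<le> dist (r k) 0"
      using *(5) by (intro always_eventually) (force simp: dist_commute intro: order_trans[OF less_imp_le])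
  qed
  have pL: "p \<in> path_image \<gamma>" unfolding p_def by (rule pathstart_in_path_image)
  show thesis
  proof (rule that)
    show "e 0 \<in> ball (pathstart \<gamma>) R - path_image \<gamma>" using *(5)[of 0] r0 by (simp add: p_def)
    fix g a a' b c
    assume A: "smooth_curve_on {a<..<c} g" "g b = e 0" "\<And>x. x \<in> {a<..<c} \<Longrightarrow> g x \<notin> path_image \<gamma>"
       "a < a'" "a' \<le> b" "b < c" "\<And>x. x \<in> {a<..a'} \<Longrightarrow> g x \<notin> ball (pathstart \<gamma>) R"
    obtain h t where "a' < t" "t \<le> b" "smooth_curve_on {a<..<t} h" "(h \<longlongrightarrow> p) (at_left t)"
      "\<And>x. x \<in> {a<..<t} \<Longrightarrow> h x \<notin> path_image \<gamma>"
      "\<And>x. x \<in> {a<..<t} \<Longrightarrow> g x \<notin> ball p (r 0) \<Longrightarrow> h x = g x"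
      "\<And>x. x \<in> {a<..<t} \<Longrightarrow> g x \<in> ball p (r 0) \<Longrightarrow> h x \<in> ball p (r 0)"
      using limit_of_pushes[OF *(1,2,3) pL dec rlim *(4) elim A(1-6)] A(7) unfolding r0 p_def by metis
    then show "\<exists>h t. a' < t \<and> t \<le> b \<and> smooth_curve_on {a<..<t} h \<and> (h \<longlongrightarrow> pathstart \<gamma>) (at_left t) \<and>
       (\<forall>x\<in>{a<..<t}. h x \<notin> path_image \<gamma> \<and>
          (if g x \<in> ball (pathstart \<gamma>) R then h x \<in> ball (pathstart \<gamma>) R else h x = g x))"
      unfolding r0 p_def by (intro exI[of _ h] exI[of _ t]) auto
  qed
qed

section \<open>Closing up the loop\<close>

lemma smooth_curve_with_endpoints:
  fixes h :: "real \<Rightarrow> 'a::euclidean_space"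
  assumes st: "s < t" and h: "smooth_curve_on {s<..<t} h"
    and lim: "(h \<longlongrightarrow> q) (at_right s)" "(h \<longlongrightarrow> p) (at_left t)"
    and pq: "p \<noteq> q" "p \<notin> h ` {s<..<t}" "q \<notin> h ` {s<..<t}"
  obtains f where "arc f" "pathstart f = q" "pathfinish f = p"
    "path_image f = insert p (insert q (h ` {s<..<t}))" "smooth_open_arc (h ` {s<..<t})"
proof -
  \<comment> \<open>Extending \<open>h\<close> by its two limits gives a continuous injective curve
    on the closed interval; \<open>u\<close> rescales it to the unit interval.\<close>
  define H where "H x = (if x \<le> s then q else if t \<le> x then p else h x)" for x
  define u where "u x = (t - s) * x + s" for x
  define f where "f x = H (u x)" for x
  have HI: "H x = h x" if "x \<in> {s<..<t}" for x using that by (simp add: H_def)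
  have Hs: "H s = q" and Ht: "H t = p" using st by (auto simp: H_def)
  have contH: "continuous_on {s..t} H"
  proof (rule continuous_on_IccI[OF _ _ _ st])
    have "\<forall>\<^sub>F x in at_right s. h x = H x" "\<forall>\<^sub>F x in at_left t. h x = H x"
      using st HI by (auto intro!: eventually_at_rightI[of s t] eventually_at_leftI[of s t])
    then show "(H \<longlongrightarrow> H s) (at_right s)" "(H \<longlongrightarrow> H t) (at_left t)"
      using lim Lim_transform_eventually unfolding Hs Ht by blast+
    fix x assume x: "s < x" "x < t"
    then have "isCont h x"
      using smooth_curve_on_continuous[OF h] continuous_on_eq_continuous_at[of "{s<..<t}" h] by simp
    then have "h \<midarrow>x\<rightarrow> H x" using x by (simp add: isCont_def H_def)
    moreover have "\<forall>\<^sub>F y in at x. h y = H y"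
      using x HI by (intro eventually_at_in_open'[of "{s<..<t}", THEN eventually_mono]) auto
    ultimately show "H \<midarrow>x\<rightarrow> H x" using Lim_transform_eventually by blast
  qed
  have injh: "inj_on h {s<..<t}" using h by (simp add: smooth_curve_on_def)
  have injH: "inj_on H {s..t}"
  proof (rule inj_onI)
    fix x y assume xy: "x \<in> {s..t}" "y \<in> {s..t}" "H x = H y"
    then consider "x = s" | "x = t" | "x \<in> {s<..<t}" by force
    moreover from xy consider "y = s" | "y = t" | "y \<in> {s<..<t}" by force
    ultimately show "x = y"
      using xy(3) pq Hs Ht HI injh by (smt (verit, best) imageI inj_on_def)
  qed
  have u01: "u ` {0..1} = {s..t}" and u01': "u ` {0<..<1} = {s<..<t}"
  proof -
    have inv: "u ((y - s) / (t - s)) = y" for y using st by (simp add: u_def)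
    have "u x \<in> {s..t}" if "x \<in> {0..1}" for x
    proof -
      have "(t - s) * x \<le> (t - s) * 1" "0 \<le> (t - s) * x" using that st by (auto intro!: mult_left_mono)
      then show ?thesis by (simp add: u_def)
    qed
    moreover have "y \<in> u ` {0..1}" if "y \<in> {s..t}" for y
      using that st inv[of y] by (intro image_eqI[of _ _ "(y - s) / (t - s)"]) auto
    ultimately show "u ` {0..1} = {s..t}" by blast
    have "u x \<in> {s<..<t}" if "x \<in> {0<..<1}" for x
    proof -
      have "(t - s) * x < (t - s) * 1" "0 < (t - s) * x"
        using that st by (auto intro!: mult_strict_left_mono)
      then show ?thesis by (simp add: u_def)
    qed
    moreover have "y \<in> u ` {0<..<1}" if "y \<in> {s<..<t}" for y
      using that st inv[of y] by (intro image_eqI[of _ _ "(y - s) / (t - s)"]) auto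
    ultimately show "u ` {0<..<1} = {s<..<t}" by blast
  qed
  have injf: "inj_on f {0..1}"
  proof (rule inj_onI)
    fix x y assume xy: "x \<in> {0..1}" "y \<in> {0..1}" "f x = f y"
    then have "u x = u y" using injH u01 unfolding f_def by (metis image_eqI inj_onD)
    then show "x = y" using st by (simp add: u_def)
  qed
  have contf: "continuous_on {0..1} f"
    unfolding f_def
    by (rule continuous_on_compose2[OF contH]) (auto simp: u_def[abs_def] u01[unfolded u_def[abs_def]] intro!: continuous_intros)
  have arcf: "arc f" using injf contf by (simp add: arc_def path_def)
  have f0: "f 0 = q" and f1: "f 1 = p" by (auto simp: f_def u_def Hs Ht)
  have fI: "f ` {0<..<1} = h ` {s<..<t}"
    using u01' HI unfolding f_def by (metis (mono_tags, lifting) image_cong image_image)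
  have "{0..1::real} = insert 1 (insert 0 {0<..<1})" by auto
  then have img: "f ` {0..1} = insert p (insert q (h ` {s<..<t}))"
    by (simp only: image_insert f0 f1 fI)
  \<comment> \<open>Compactness makes the inverse continuous; restricted to the open arc it is the
    inverse that \<open>smooth_open_arc\<close> asks for.\<close>
  obtain k where k: "homeomorphism {0..1} (f ` {0..1}) f k"
    using homeomorphism_compact[OF compact_Icc contf refl injf] by blast
  have "homeomorphism {0<..<1} (h ` {s<..<t}) f k"
    by (rule homeomorphism_of_subsets[OF k]) (use fI in auto)
  moreover have "smooth_curve_on {0<..<1} f"
  proof (rule smooth_curve_on_cong[OF _ open_greaterThanLessThan])
    show "smooth_curve_on {0<..<1} (\<lambda>x. h ((t - s) * x + s))"
      using smooth_curve_on_affine[OF h, where c = "t - s" and d = s and S = "{0<..<1}"] st u01' by (simp add: u_def[abs_def])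
    fix x :: real assume "x \<in> {0<..<1}"
    then have "u x \<in> {s<..<t}" using u01' by blast
    then show "h ((t - s) * x + s) = f x" using HI by (simp add: f_def u_def)
  qed
  ultimately have "smooth_open_arc (h ` {s<..<t})"
    unfolding smooth_open_arc_def smooth_curve_on_def C_infinity_on_iff[OF open_greaterThanLessThan]
    by blast
  then show thesis using that[OF arcf] f0 f1 img by (simp add: pathstart_def pathfinish_def path_image_def)
qed

text \<open>A smooth curve off the arc is made to pass through the two prescribed points near
  \<open>p\<close> and \<open>q\<close>. One end is redirected to \<open>q\<close>, the parameter is
  reversed, and the other end is redirected to \<open>p\<close>. The balls where the changes happen
  are disjoint, so the second change preserves the first end.\<close>

lemma arc_extends_to_smooth_loop:
  fixes \<gamma> :: "real \<Rightarrow> 'a::euclidean_space"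
  assumes dim: "2 \<le> DIM('a)" and \<gamma>: "arc \<gamma>" and \<Omega>: "open \<Omega>" "path_image \<gamma> \<subseteq> \<Omega>"
  obtains f where "arc f" "pathstart f = pathfinish \<gamma>" "pathfinish f = pathstart \<gamma>"
    "path_image f \<subseteq> \<Omega>" "path_image f \<inter> path_image \<gamma> = {pathstart \<gamma>, pathfinish \<gamma>}"
    "smooth_open_arc (path_image f - path_image \<gamma>)"
proof -
  define L p q where "L = path_image \<gamma>" and "p = pathstart \<gamma>" and "q = pathfinish \<gamma>"
  have pqL: "p \<in> L" "q \<in> L" by (simp_all add: L_def p_def q_def pathstart_in_path_image pathfinish_in_path_image)
  have pq: "p \<noteq> q" using \<gamma> arc_distinct_ends unfolding p_def q_def by metis
  have cL: "compact L" "connected L"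
    using \<gamma> by (auto simp: L_def compact_arc_image connected_arc_image)
  obtain B where B: "L \<subseteq> ball p B" "0 < B"
    using bounded_subset_ballD[OF compact_imp_bounded[OF cL(1)]] by metis
  \<comment> \<open>A bounded connected open set between \<open>L\<close> and
    \<open>\<Omega>\<close>, as \<open>connected_open_Diff_arc\<close> requires.\<close>
  define U where "U = connected_component_set (\<Omega> \<inter> ball p B) p"
  have U: "open U" "connected U" "U \<subseteq> \<Omega> \<inter> ball p B"
    unfolding U_def using \<Omega>(1)
    using connected_component_subset open_connected_component[of "\<Omega> \<inter> ball p B" p] by auto
  have "bounded U" using U(3) bounded_ball bounded_subset by blast
  have LU: "L \<subseteq> U" unfolding U_def
    using cL(2) pqL B \<Omega>(2) by (intro connected_component_maximal) (auto simp: L_def)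
  define W where "W = U - L"
  have W: "open W" "connected W"
    unfolding W_def using U cL compact_imp_closed connected_open_Diff_arc[OF dim \<gamma> U(1,2) \<open>bounded U\<close>] LU
    by (auto simp: L_def open_Diff)
  obtain e1 e2 where e12: "0 < e1" "ball p e1 \<subseteq> U" "0 < e2" "ball q e2 \<subseteq> U"
    using U(1) LU pqL by (meson openE subsetD)
  define R where "R = min (dist p q / 2) (min e1 e2)"
  have R: "0 < R" "2 * R \<le> dist p q" using e12 pq by (auto simp: R_def)
  have RU: "ball p R \<subseteq> U" "ball q R \<subseteq> U" using e12 by (auto simp: R_def)
  have apart: "R < dist q z" if "z \<in> ball p R" for z
    using that R dist_triangle[of p q z] by (simp add: dist_commute)

  obtain ep where ep: "ep \<in> ball p R - L"
    and end_p: "\<And>g a a' b c. \<lbrakk>smooth_curve_on {a<..<c} g; g b = ep; \<And>x. x \<in> {a<..<c} \<Longrightarrow> g x \<notin> L;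
       a < a'; a' \<le> b; b < c; \<And>x. x \<in> {a<..a'} \<Longrightarrow> g x \<notin> ball p R\<rbrakk> \<Longrightarrow>
     \<exists>h t. a' < t \<and> t \<le> b \<and> smooth_curve_on {a<..<t} h \<and> (h \<longlongrightarrow> p) (at_left t) \<and>
       (\<forall>x\<in>{a<..<t}. h x \<notin> L \<and> (if g x \<in> ball p R then h x \<in> ball p R else h x = g x))"
    using smooth_curve_redirect_to_arc_start[OF dim \<gamma> R(1)] unfolding L_def p_def by metis
  \<comment> \<open>The reversed arc starts at \<open>q\<close>, so the redirection lemma for
    starting points covers this end too.\<close>
  have rev: "arc (reversepath \<gamma>)" using \<gamma> by (rule arc_reversepath)
  obtain eq where eq: "eq \<in> ball q R - L"
    and end_q: "\<And>g a a' b c. \<lbrakk>smooth_curve_on {a<..<c} g; g b = eq; \<And>x. x \<in> {a<..<c} \<Longrightarrow> g x \<notin> L;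
       a < a'; a' \<le> b; b < c; \<And>x. x \<in> {a<..a'} \<Longrightarrow> g x \<notin> ball q R\<rbrakk> \<Longrightarrow>
     \<exists>h t. a' < t \<and> t \<le> b \<and> smooth_curve_on {a<..<t} h \<and> (h \<longlongrightarrow> q) (at_left t) \<and>
       (\<forall>x\<in>{a<..<t}. h x \<notin> L \<and> (if g x \<in> ball q R then h x \<in> ball q R else h x = g x))"
    using smooth_curve_redirect_to_arc_start[OF dim rev R(1)]
    unfolding L_def q_def path_image_reversepath pathstart_reversepath by metis
  have epW: "ep \<in> W" and eqW: "eq \<in> W" using ep eq RU by (auto simp: W_def)
  have "eq \<noteq> ep" using apart[of ep] ep eq by auto

  obtain d where d: "0 < d" "ball ep d \<subseteq> W" using W(1) epW openE by blast
  obtain v0 :: 'a where v0: "norm v0 = d / 2" using vector_choose_size[of "d / 2"] d(1) by auto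
  have v0': "v0 \<noteq> 0" using v0 d by auto
  have line: "ep + x *\<^sub>R v0 \<in> W" if "x \<in> {-1<..<2}" for x
  proof -
    have "\<bar>x\<bar> * norm v0 < 2 * norm v0"
      using that v0' by (intro mult_strict_right_mono) auto
    moreover have "2 * norm v0 = d" using v0 by simp
    ultimately have "norm (x *\<^sub>R v0) < d" by (simp only: norm_scaleR)
    then have "ep + x *\<^sub>R v0 \<in> ball ep d" by (simp add: dist_norm)
    then show ?thesis using d by blast
  qed
  have in_del: "ep + v0 \<in> W - {ep}" "eq \<in> W - {ep}"
    using line[of 1] v0' eqW \<open>eq \<noteq> ep\<close> by auto
  \<comment> \<open>The push acts off \<open>ep\<close>, so it moves the far end of the segment to
    \<open>eq\<close> while \<open>ep\<close> stays put. The segment is taken over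
    \<open>{-1<..<2}\<close> so that it runs beyond both points.\<close>
  obtain K0 \<phi>0 where \<phi>0: "K0 \<subseteq> W - {ep}" "pushes_within K0 \<phi>0" "\<phi>0 (ep + v0) = eq"
    using push_transitive[OF open_delete[OF W(1)] connected_open_delete[OF W dim] in_del] by blast
  define g where "g x = \<phi>0 (ep + x *\<^sub>R v0)" for x
  have g: "smooth_curve_on {-1<..<2} g"
    unfolding g_def
    by (rule smooth_curve_on_push[OF smooth_curve_on_line[OF v0'] \<phi>0(2)])
  have gW: "g x \<in> W" if "x \<in> {-1<..<2}" for x
    using line[OF that] \<phi>0 pushes_within_image[OF \<phi>0(2)] pushes_within_outside[OF \<phi>0(2)]
    unfolding g_def by (metis Diff_iff subsetD)
  have g0: "g 0 = ep" and g1: "g 1 = eq"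
    using \<phi>0(1,3) pushes_within_outside[OF \<phi>0(2), of ep] by (auto simp: g_def)

  have "open ({-1<..<2} \<inter> g -` (- cball q R))"
    using smooth_curve_on_continuous[OF g] by (intro continuous_open_preimage) auto
  moreover have "0 \<in> {-1<..<2} \<inter> g -` (- cball q R)"
    using apart[of ep] ep by (simp add: g0)
  ultimately obtain n0 where n0: "0 < n0" "cball 0 n0 \<subseteq> {-1<..<2} \<inter> g -` (- cball q R)"
    using open_contains_cball by metis
  \<comment> \<open>Around parameter 0 the curve is away from \<open>q\<close>, so the first
    redirection leaves it unchanged there. It still passes through \<open>ep\<close> and continues
    beyond, ready for the second redirection.\<close>
  define \<eta> where "\<eta> = min n0 (1/2)"
  have \<eta>: "0 < \<eta>" "\<eta> < 1" using n0 by (auto simp: \<eta>_def)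
  have g_far: "g x \<notin> ball q R" if "x \<in> {-\<eta><..\<eta>}" for x
  proof -
    have "x \<in> cball 0 n0" using that by (auto simp: \<eta>_def)
    then show ?thesis using n0(2) by force
  qed
  have "\<exists>h t. \<eta> < t \<and> t \<le> 1 \<and> smooth_curve_on {-\<eta><..<t} h \<and> (h \<longlongrightarrow> q) (at_left t) \<and>
       (\<forall>x\<in>{-\<eta><..<t}. h x \<notin> L \<and> (if g x \<in> ball q R then h x \<in> ball q R else h x = g x))"
  proof (rule end_q[where c = 2])
    have "{-\<eta><..<2} \<subseteq> {-1<..<2}" using \<eta> by auto
    then show "smooth_curve_on {-\<eta><..<2} g"
      by (rule smooth_curve_on_subset[OF g])
    show "g x \<notin> L" if "x \<in> {-\<eta><..<2}" for x
      using gW[of x] that \<eta> by (auto simp: W_def)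
  qed (use g1 \<eta> g_far in auto)
  then obtain h1 t1 where h1: "\<eta> < t1" "t1 \<le> 1" "smooth_curve_on {-\<eta><..<t1} h1" "(h1 \<longlongrightarrow> q) (at_left t1)"
    "\<And>x. x \<in> {-\<eta><..<t1} \<Longrightarrow> h1 x \<notin> L"
    "\<And>x. x \<in> {-\<eta><..<t1} \<Longrightarrow> g x \<in> ball q R \<Longrightarrow> h1 x \<in> ball q R"
    "\<And>x. x \<in> {-\<eta><..<t1} \<Longrightarrow> g x \<notin> ball q R \<Longrightarrow> h1 x = g x"
    by metis
  have h1U: "h1 x \<in> U" if "x \<in> {-\<eta><..<t1}" for x
    using h1(6,7)[OF that] RU(2) gW[of x] that h1(2) \<eta> by (cases "g x \<in> ball q R") (auto simp: W_def)
  have h10: "h1 0 = ep" using h1(7)[of 0] h1(1) g_far[of 0] \<eta> g0 by auto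

  \<comment> \<open>After reversal the finished end at \<open>q\<close> sits at \<open>-t1\<close>,
    and the curve meets \<open>ep\<close> at 0 before the end \<open>\<eta>\<close> of its
    domain.\<close>
  define k where "k x = h1 (- x)" for x
  have k: "smooth_curve_on {-t1<..<\<eta>} k"
    using smooth_curve_on_affine[OF h1(3), where c = "-1" and d = 0 and S = "{-t1<..<\<eta>}"] by (auto simp: k_def[abs_def])
  have klim: "(k \<longlongrightarrow> q) (at_right (-t1))"
    using h1(4) by (simp add: filterlim_at_left_to_right k_def[abs_def])
  have "q \<in> - cball p R" using R pq by (auto simp: dist_commute)
  then have "\<forall>\<^sub>F x in at_right (-t1). k x \<in> - cball p R"
    using topological_tendstoD[OF klim] by (metis closed_cball open_Compl)
  then obtain m where m: "-t1 < m" "\<And>y. -t1 < y \<Longrightarrow> y < m \<Longrightarrow> k y \<in> - cball p R"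
    unfolding eventually_at_right_field by blast
  \<comment> \<open>The midpoint of \<open>-t1\<close> and \<open>m\<close> lies where
    \<open>k\<close> is still outside the ball about \<open>p\<close>, and \<open>- t1 / 2\<close>
    ensures \<open>a' < 0\<close>. The second redirection changes nothing up to \<open>a'\<close>,
    so the limit \<open>q\<close> at \<open>-t1\<close> persists.\<close>
  define a' where "a' = min ((m - t1) / 2) (- t1 / 2)"
  have a': "-t1 < a'" "a' < m" "a' < 0" using m(1) h1(1) \<eta> by (auto simp: a'_def min_def)
  have k_far: "k x \<notin> ball p R" if "x \<in> {-t1<..a'}" for x
    using m(2)[of x] that a' by auto
  have "\<exists>h t. a' < t \<and> t \<le> 0 \<and> smooth_curve_on {-t1<..<t} h \<and> (h \<longlongrightarrow> p) (at_left t) \<and>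
       (\<forall>x\<in>{-t1<..<t}. h x \<notin> L \<and> (if k x \<in> ball p R then h x \<in> ball p R else h x = k x))"
  proof (rule end_p[OF k])
    show "k x \<notin> L" if "x \<in> {-t1<..<\<eta>}" for x using h1(5)[of "-x"] that by (simp add: k_def)
  qed (use h10 \<eta> a' k_far in \<open>auto simp: k_def\<close>)
  then obtain h t where h: "a' < t" "t \<le> 0" "smooth_curve_on {-t1<..<t} h" "(h \<longlongrightarrow> p) (at_left t)"
    "\<And>x. x \<in> {-t1<..<t} \<Longrightarrow> h x \<notin> L"
    "\<And>x. x \<in> {-t1<..<t} \<Longrightarrow> k x \<in> ball p R \<Longrightarrow> h x \<in> ball p R"
    "\<And>x. x \<in> {-t1<..<t} \<Longrightarrow> k x \<notin> ball p R \<Longrightarrow> h x = k x"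
    by metis
  have hU: "h x \<in> U" if "x \<in> {-t1<..<t}" for x
  proof (cases "k x \<in> ball p R")
    case True
    then show ?thesis using h(6)[OF that] RU by blast
  next
    case False
    then show ?thesis using h(2) h(7)[OF that] h1U[of "-x"] that \<eta> by (simp add: k_def)
  qed
  have "\<forall>\<^sub>F x in at_right (-t1). k x = h x"
    using a' h(1,7) k_far by (intro eventually_at_rightI[of _ a']) auto
  then have hlim: "(h \<longlongrightarrow> q) (at_right (-t1))" using klim by (rule Lim_transform_eventually[rotated])
  have "-t1 < t" using a' h(1) by simp
  moreover have hL: "h ` {-t1<..<t} \<inter> L = {}" using h(5) by blast
  ultimately obtain f where f: "arc f" "pathstart f = q" "pathfinish f = p"
    "path_image f = insert p (insert q (h ` {-t1<..<t}))" "smooth_open_arc (h ` {-t1<..<t})"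
    using smooth_curve_with_endpoints[OF _ h(3) hlim h(4) pq] pqL by (metis disjoint_iff)
  have "path_image f - L = h ` {-t1<..<t}" "path_image f \<inter> L = {p, q}"
    unfolding f(4) using pqL hL by auto
  moreover have "path_image f \<subseteq> \<Omega>"
    using f(4) pqL LU U(3) hU by auto
  ultimately show thesis
    using that f unfolding p_def q_def L_def by metis
qed

theorem theorem1p2:
  fixes lam \<Omega> :: "(real ^ 'n) set"
  assumes "CARD('n) \<ge> 2"
    and "is_arc lam"
    and "open \<Omega>"
    and "lam \<subseteq> \<Omega>"
  shows "\<exists>\<gamma>. simple_closed_curve \<gamma> \<and> \<gamma> \<subseteq> \<Omega> \<and> lam \<subseteq> \<gamma> \<and> smooth_open_arc (\<gamma> - lam)"
proof -
  obtain c d where "homeomorphism {0..(1::real)} lam c d"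
    using assms(2) homeomorphic_sym unfolding is_arc_def homeomorphic_def by blast
  then have c: "arc c" "path_image c = lam"
    unfolding arc_def path_def path_image_def homeomorphism_def by (auto intro: inj_on_inverseI)
  have "2 \<le> DIM(real ^ 'n)" using assms(1) by simp
  then obtain f where f: "arc f" "pathstart f = pathfinish c" "pathfinish f = pathstart c"
    "path_image f \<subseteq> \<Omega>" "path_image f \<inter> path_image c = {pathstart c, pathfinish c}"
    "smooth_open_arc (path_image f - path_image c)"
    using arc_extends_to_smooth_loop[OF _ c(1) assms(3)] assms(4) c(2) by metis
  define \<gamma> where "\<gamma> = path_image (c +++ f)"
  have un: "\<gamma> = lam \<union> path_image f"
    unfolding \<gamma>_def using f(2) c(2) by (simp add: path_image_join)
  have "simple_path (c +++ f)"
    using simple_path_join_loop[OF c(1) f(1)] f by auto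
  moreover have "pathfinish (c +++ f) = pathstart (c +++ f)" using f by simp
  ultimately have "simple_closed_curve \<gamma>"
    unfolding simple_closed_curve_def \<gamma>_def by (rule homeomorphic_simple_path_image_circle) simp
  moreover have "\<gamma> - lam = path_image f - path_image c" using un c(2) by blast
  ultimately show ?thesis using un f assms(4) by (intro exI[of _ \<gamma>]) auto
qed

end
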